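(* Let $\pi\colon X\to\mathbb{P}^1$ be a standard fibration and let $D\in(\mathbb{P}^1)^{(1)}$. Let $E$ be the field of definition of the elements of $S_D$ and let $N/\mathbb{Q}$ be a number field. Then $$\delta_{D,N}(\pi)=\delta_{D,\,N\cap E^{\mathrm{normal}}}(\pi),$$ where $E^{\mathrm{normal}}$ is the normal closure of $E$.
   Context: A standard fibration is a dominant morphism $\pi\colon X\to\mathbb{P}^1$ with geometrically integral generic fibre, where $X$ is a smooth, proper, geometrically irreducible variety over $\mathbb{Q}$. $(\mathbb{P}^1)^{(1)}$ is the set of closed points of $\mathbb{P}^1$ over $\mathbb{Q}$. Number fields are taken inside a fixed algebraic closure $\overline{\mathbb{Q}}$, and the normal closure of $E$ is taken in $\overline{\mathbb{Q}}$ (over $\mathbb{Q}$). For $D\in(\mathbb{P}^1)^{(1)}$, $m_D\geq 1$ is the minimum multiplicity of the irreducible components of $\pi^{-1}(D)$, and $S_D$ is the set of geometrically irreducible components (that is, geometric components) of $\pi^{-1}(D)$ of multiplicity $m_D$. For any number field $N/\mathbb{Q}$, put $$\delta_{D,N}(\pi)=\frac{\#\{\sigma\in\Gamma_{D,N}:\sigma\text{ acts with a fixed point on }S_D\}}{\#\Gamma_{D,N}},$$ where $\Gamma_{D,N}$ is a finite group through which the action of $\mathrm{Gal}(\overline{N}/N)$ on $S_D$ factors (and $\delta_{D,N}(\pi)=0$ when no such components exist). For arbitrary $N$ this quantity is used in the form $$\delta_{D,N}(\pi)=\frac{\#\{\sigma\in\mathrm{Gal}(L/N):\sigma\text{ fixes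 a conjugate of }E\}}{\#\mathrm{Gal}(L/N)},$$ where $L\subseteq\overline{\mathbb{Q}}$ is a Galois extension of $\mathbb{Q}$ containing both $N$ and $E$. *)

theory Defs
  imports
    "HOL-Algebra.Algebraic_Closure_Type"
    "HOL-Algebra.Generated_Rings"
    "HOL-Algebra.Ring_Divisibility"
    "HOL-Algebra.Group_Action"
    "HOL-Library.Extended_Nat"
    "HOL-Analysis.Abstract_Topology"
begin

text \<open>
  The type \<open>'u\<close> is a universe: points and sections of every scheme under consideration are elements
  of \<open>'u\<close>, and statements about ``all schemes'' or ``all field extensions'' (universal properties,
  universal closedness, geometric properties) range over the schemes in that universe. A nonempty
  scheme over \<open>\<rat>\<close> forces \<open>'u\<close> to be infinite, and then \<open>'u\<close> contains, up to isomorphism, every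
  scheme of finite type over a field no larger than \<open>'u\<close>, with all fibre products needed below.
\<close>


section \<open>Schemes\<close>

record 'u ringed_space =
  Top :: "'u topology"
  Sec :: "'u set \<Rightarrow> 'u ring"
  Res :: "'u set \<Rightarrow> 'u set \<Rightarrow> 'u \<Rightarrow> 'u"

abbreviation space :: "'u ringed_space \<Rightarrow> 'u set" where
  "space \<XX> \<equiv> topspace (Top \<XX>)"

abbreviation global :: "'u ringed_space \<Rightarrow> 'u ring" where
  "global \<XX> \<equiv> Sec \<XX> (space \<XX>)"

text \<open>
  \<open>Res \<XX> U V\<close> is the restriction from \<open>U\<close> to \<open>V\<close>. (The letter X is reserved as notation for a
  polynomial variable in \<^theory>\<open>HOL-Algebra.Polynomials\<close>.)
\<close>

definition sheaf_of_rings :: "'u ringed_space \<Rightarrow> bool" where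
  "sheaf_of_rings \<XX> \<longleftrightarrow>
     (\<forall>U. openin (Top \<XX>) U \<longrightarrow> cring (Sec \<XX> U)) \<and>
     (\<forall>U V. openin (Top \<XX>) U \<and> openin (Top \<XX>) V \<and> V \<subseteq> U \<longrightarrow>
        Res \<XX> U V \<in> ring_hom (Sec \<XX> U) (Sec \<XX> V)) \<and>
     (\<forall>U. openin (Top \<XX>) U \<longrightarrow> (\<forall>s \<in> carrier (Sec \<XX> U). Res \<XX> U U s = s)) \<and>
     (\<forall>U V W. openin (Top \<XX>) U \<and> openin (Top \<XX>) V \<and> openin (Top \<XX>) W \<and> W \<subseteq> V \<and> V \<subseteq> U \<longrightarrow>
        (\<forall>s \<in> carrier (Sec \<XX> U). Res \<XX> V W (Res \<XX> U V s) = Res \<XX> U W s)) \<and>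
     (\<forall>\<U> s. (\<forall>U \<in> \<U>. openin (Top \<XX>) U \<and> s U \<in> carrier (Sec \<XX> U)) \<and>
        (\<forall>U \<in> \<U>. \<forall>V \<in> \<U>. Res \<XX> U (U \<inter> V) (s U) = Res \<XX> V (U \<inter> V) (s V)) \<longrightarrow>
        (\<exists>!t. t \<in> carrier (Sec \<XX> (\<Union>\<U>)) \<and> (\<forall>U \<in> \<U>. Res \<XX> (\<Union>\<U>) U t = s U)))"

text \<open>The germ at \<open>x\<close> of the section \<open>s\<close> over \<open>U\<close> is a unit of the local ring at \<open>x\<close>.\<close>

definition invertible_at :: "'u ringed_space \<Rightarrow> 'u set \<Rightarrow> 'u \<Rightarrow> 'u \<Rightarrow> bool" where
  "invertible_at \<XX> U s x \<longleftrightarrow>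
     (\<exists>W. openin (Top \<XX>) W \<and> x \<in> W \<and> W \<subseteq> U \<and> Res \<XX> U W s \<in> Units (Sec \<XX> W))"

definition nonvanishing :: "'u ringed_space \<Rightarrow> 'u set \<Rightarrow> 'u \<Rightarrow> 'u set" where
  "nonvanishing \<XX> U s = {x \<in> U. invertible_at \<XX> U s x}"

text \<open>
  \<open>U\<close> is affine iff the canonical map from \<open>U\<close> to the spectrum of its ring \<open>A\<close> of sections, sending
  \<open>x\<close> to the prime ideal of those \<open>s\<close> whose germ at \<open>x\<close> is not a unit, is an isomorphism of ringed
  spaces: it is bijective, it identifies the topologies, and for each \<open>s\<close> the restriction to the
  basic open set of \<open>s\<close> is the localization of \<open>A\<close> at the powers of \<open>s\<close>.
\<close>

definition affine_open :: "'u ringed_space \<Rightarrow> 'u set \<Rightarrow> bool" where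
  "affine_open \<XX> U \<longleftrightarrow> openin (Top \<XX>) U \<and>
     bij_betw (\<lambda>x. {s \<in> carrier (Sec \<XX> U). \<not> invertible_at \<XX> U s x}) U
       {I. primeideal I (Sec \<XX> U)} \<and>
     (\<forall>V \<subseteq> U. openin (Top \<XX>) V \<longleftrightarrow>
        (\<exists>S \<subseteq> carrier (Sec \<XX> U). V = (\<Union>s \<in> S. nonvanishing \<XX> U s))) \<and>
     (\<forall>s \<in> carrier (Sec \<XX> U). let V = nonvanishing \<XX> U s; r = Res \<XX> U V in
        r s \<in> Units (Sec \<XX> V) \<and>
        (\<forall>t \<in> carrier (Sec \<XX> V). \<exists>a \<in> carrier (Sec \<XX> U). \<exists>n::nat.
           t \<otimes>\<^bsub>Sec \<XX> V\<^esub> (r s [^]\<^bsub>Sec \<XX> V\<^esub> n) = r a) \<and>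
        (\<forall>a \<in> carrier (Sec \<XX> U). r a = \<zero>\<^bsub>Sec \<XX> V\<^esub> \<longrightarrow>
           (\<exists>n::nat. (s [^]\<^bsub>Sec \<XX> U\<^esub> n) \<otimes>\<^bsub>Sec \<XX> U\<^esub> a = \<zero>\<^bsub>Sec \<XX> U\<^esub>)))"

definition scheme :: "'u ringed_space \<Rightarrow> bool" where
  "scheme \<XX> \<longleftrightarrow> sheaf_of_rings \<XX> \<and> space \<XX> = \<Union>{U. affine_open \<XX> U}"


subsection \<open>Morphisms\<close>

record 'u morph =
  pt :: "'u \<Rightarrow> 'u"
  sh :: "'u set \<Rightarrow> 'u \<Rightarrow> 'u"

definition preim :: "'u ringed_space \<Rightarrow> 'u morph \<Rightarrow> 'u set \<Rightarrow> 'u set" where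
  "preim \<XX> f V = {x \<in> space \<XX>. pt f x \<in> V}"

text \<open>
  \<open>sh f V\<close> maps sections of \<open>Y\<close> over \<open>V\<close> to sections of \<open>\<XX>\<close> over the preimage of \<open>V\<close>. The last
  clause says that the induced homomorphisms on stalks are local.
\<close>

definition morphism :: "'u ringed_space \<Rightarrow> 'u ringed_space \<Rightarrow> 'u morph \<Rightarrow> bool" where
  "morphism \<XX> Y f \<longleftrightarrow>
     continuous_map (Top \<XX>) (Top Y) (pt f) \<and>
     (\<forall>V. openin (Top Y) V \<longrightarrow> sh f V \<in> ring_hom (Sec Y V) (Sec \<XX> (preim \<XX> f V))) \<and>
     (\<forall>V W. openin (Top Y) V \<and> openin (Top Y) W \<and> W \<subseteq> V \<longrightarrow>
        (\<forall>s \<in> carrier (Sec Y V).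
           sh f W (Res Y V W s) = Res \<XX> (preim \<XX> f V) (preim \<XX> f W) (sh f V s))) \<and>
     (\<forall>V. openin (Top Y) V \<longrightarrow> (\<forall>s \<in> carrier (Sec Y V). \<forall>x \<in> preim \<XX> f V.
        invertible_at \<XX> (preim \<XX> f V) (sh f V s) x \<longrightarrow> invertible_at Y V s (pt f x)))"

text \<open>A morphism is only determined on points of \<open>\<XX>\<close> and on sections of \<open>Y\<close>.\<close>

definition eq_mor :: "'u ringed_space \<Rightarrow> 'u ringed_space \<Rightarrow> 'u morph \<Rightarrow> 'u morph \<Rightarrow> bool" where
  "eq_mor \<XX> Y f g \<longleftrightarrow>
     (\<forall>x \<in> space \<XX>. pt f x = pt g x) \<and>
     (\<forall>V. openin (Top Y) V \<longrightarrow> (\<forall>s \<in> carrier (Sec Y V). sh f V s = sh g V s))"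

definition id_mor :: "'u morph" where
  "id_mor = \<lparr>pt = (\<lambda>x. x), sh = (\<lambda>_ s. s)\<rparr>"

text \<open>\<open>comp_mor Y g f\<close> is the composition of \<open>f\<close>, with target \<open>Y\<close>, followed by \<open>g\<close>.\<close>

definition comp_mor :: "'u ringed_space \<Rightarrow> 'u morph \<Rightarrow> 'u morph \<Rightarrow> 'u morph" where
  "comp_mor Y g f = \<lparr>pt = pt g \<circ> pt f, sh = (\<lambda>V. sh f (preim Y g V) \<circ> sh g V)\<rparr>"

definition fibre_product ::
  "'u ringed_space \<Rightarrow> 'u ringed_space \<Rightarrow> 'u ringed_space \<Rightarrow> 'u morph \<Rightarrow> 'u morph \<Rightarrow>
   'u ringed_space \<Rightarrow> 'u morph \<Rightarrow> 'u morph \<Rightarrow> bool" where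
  "fibre_product \<XX> Y S f g W p q \<longleftrightarrow>
     scheme W \<and> morphism W \<XX> p \<and> morphism W Y q \<and>
     eq_mor W S (comp_mor \<XX> f p) (comp_mor Y g q) \<and>
     (\<forall>T a b. scheme T \<and> morphism T \<XX> a \<and> morphism T Y b \<and>
        eq_mor T S (comp_mor \<XX> f a) (comp_mor Y g b) \<longrightarrow>
        (\<exists>h. morphism T W h \<and> eq_mor T \<XX> (comp_mor W p h) a \<and> eq_mor T Y (comp_mor W q h) b \<and>
           (\<forall>h'. morphism T W h' \<and> eq_mor T \<XX> (comp_mor W p h') a \<and>
              eq_mor T Y (comp_mor W q h') b \<longrightarrow> eq_mor T W h' h)))"


subsection \<open>Spectra of fields and fibres\<close>

text \<open>A one-point scheme is affine, hence the spectrum of its ring of global sections.\<close>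

definition field_spectrum :: "'u ringed_space \<Rightarrow> bool" where
  "field_spectrum S \<longleftrightarrow> scheme S \<and> (\<exists>x. space S = {x}) \<and> field (global S)"

definition spectrum_of :: "'k ring \<Rightarrow> 'u ringed_space \<Rightarrow> ('k \<Rightarrow> 'u) \<Rightarrow> bool" where
  "spectrum_of K S \<iota> \<longleftrightarrow> field K \<and> field_spectrum S \<and> \<iota> \<in> ring_iso K (global S)"

text \<open>\<open>g : Spec K \<rightarrow> Spec K'\<close> is the morphism induced by the homomorphism \<open>\<phi> : K' \<rightarrow> K\<close>.\<close>

definition spec_map ::
  "'u ringed_space \<Rightarrow> ('k \<Rightarrow> 'u) \<Rightarrow> 'k ring \<Rightarrow> 'u ringed_space \<Rightarrow> ('k \<Rightarrow> 'u) \<Rightarrow> ('k \<Rightarrow> 'k) \<Rightarrow>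
   'u morph \<Rightarrow> bool" where
  "spec_map S \<iota> K' S' \<iota>' \<phi> g \<longleftrightarrow>
     morphism S S' g \<and> (\<forall>c \<in> carrier K'. sh g (space S') (\<iota>' c) = \<iota> (\<phi> c))"

text \<open>
  \<open>g : S \<rightarrow> Y\<close> is the spectrum of the residue field at \<open>y\<close>: the local homomorphism from the local
  ring at \<open>y\<close> to the field of global sections of \<open>S\<close> is surjective.
\<close>

definition residue_spectrum ::
  "'u ringed_space \<Rightarrow> 'u \<Rightarrow> 'u ringed_space \<Rightarrow> 'u morph \<Rightarrow> bool" where
  "residue_spectrum Y y S g \<longleftrightarrow>
     y \<in> space Y \<and> field_spectrum S \<and> morphism S Y g \<and> (\<forall>x \<in> space S. pt g x = y) \<and>
     (\<forall>c \<in> carrier (global S). \<exists>V. openin (Top Y) V \<and> y \<in> V \<and>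
        (\<exists>s \<in> carrier (Sec Y V). sh g V s = c))"

text \<open>\<open>F\<close>, with projections to \<open>\<XX>\<close> and to \<open>S\<close>, is the scheme-theoretic fibre of \<open>f : \<XX> \<rightarrow> Y\<close> at \<open>y\<close>.\<close>

definition fibre_at ::
  "'u ringed_space \<Rightarrow> 'u ringed_space \<Rightarrow> 'u morph \<Rightarrow> 'u \<Rightarrow>
   'u ringed_space \<Rightarrow> 'u morph \<Rightarrow> 'u ringed_space \<Rightarrow> 'u morph \<Rightarrow> bool" where
  "fibre_at \<XX> Y f y F p S q \<longleftrightarrow>
     (\<exists>g. residue_spectrum Y y S g \<and> fibre_product \<XX> S Y f g F p q)"

text \<open>\<open>\<Phi>\<close> holds for all base changes of \<open>q : F \<rightarrow> S\<close> to field extensions, \<open>S\<close> being the spectrum of a field.\<close>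

definition geometrically ::
  "('u ringed_space \<Rightarrow> bool) \<Rightarrow> 'u ringed_space \<Rightarrow> 'u ringed_space \<Rightarrow> 'u morph \<Rightarrow> bool" where
  "geometrically \<Phi> F S q \<longleftrightarrow>
     (\<forall>T g W a b. field_spectrum T \<and> morphism T S g \<and> fibre_product F T S q g W a b \<longrightarrow> \<Phi> W)"


subsection \<open>Irreducibility, local rings and multiplicities\<close>

definition irreducible_in :: "'u topology \<Rightarrow> 'u set \<Rightarrow> bool" where
  "irreducible_in T Z \<longleftrightarrow> Z \<subseteq> topspace T \<and> Z \<noteq> {} \<and>
     (\<forall>A B. closedin T A \<and> closedin T B \<and> Z \<subseteq> A \<union> B \<longrightarrow> Z \<subseteq> A \<or> Z \<subseteq> B)"

definition irreducible_components :: "'u ringed_space \<Rightarrow> 'u set set" where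
  "irreducible_components \<XX> =
     {Z. irreducible_in (Top \<XX>) Z \<and> (\<forall>Z'. irreducible_in (Top \<XX>) Z' \<and> Z \<subseteq> Z' \<longrightarrow> Z' = Z)}"

definition irreducible_scheme :: "'u ringed_space \<Rightarrow> bool" where
  "irreducible_scheme \<XX> \<longleftrightarrow> irreducible_in (Top \<XX>) (space \<XX>)"

definition integral_scheme :: "'u ringed_space \<Rightarrow> bool" where
  "integral_scheme \<XX> \<longleftrightarrow> space \<XX> \<noteq> {} \<and> (\<forall>U. openin (Top \<XX>) U \<and> U \<noteq> {} \<longrightarrow> domain (Sec \<XX> U))"

definition germ :: "'u ringed_space \<Rightarrow> 'u \<Rightarrow> 'u set \<Rightarrow> 'u \<Rightarrow> ('u set \<times> 'u) set" where
  "germ \<XX> x U s = {(V, t). openin (Top \<XX>) V \<and> x \<in> V \<and> t \<in> carrier (Sec \<XX> V) \<and>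
     (\<exists>W. openin (Top \<XX>) W \<and> x \<in> W \<and> W \<subseteq> U \<inter> V \<and> Res \<XX> U W s = Res \<XX> V W t)}"

definition germ_op ::
  "'u ringed_space \<Rightarrow> 'u \<Rightarrow> ('u ring \<Rightarrow> 'u \<Rightarrow> 'u \<Rightarrow> 'u) \<Rightarrow>
   ('u set \<times> 'u) set \<Rightarrow> ('u set \<times> 'u) set \<Rightarrow> ('u set \<times> 'u) set" where
  "germ_op \<XX> x opn a b = (\<Union>(U, s) \<in> a. \<Union>(V, t) \<in> b.
     germ \<XX> x (U \<inter> V) (opn (Sec \<XX> (U \<inter> V)) (Res \<XX> U (U \<inter> V) s) (Res \<XX> V (U \<inter> V) t)))"

definition stalk :: "'u ringed_space \<Rightarrow> 'u \<Rightarrow> ('u set \<times> 'u) set ring" where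
  "stalk \<XX> x = \<lparr>
     carrier = {germ \<XX> x U s | U s. openin (Top \<XX>) U \<and> x \<in> U \<and> s \<in> carrier (Sec \<XX> U)},
     monoid.mult = germ_op \<XX> x monoid.mult,
     one = germ \<XX> x (space \<XX>) \<one>\<^bsub>global \<XX>\<^esub>,
     ring.zero = germ \<XX> x (space \<XX>) \<zero>\<^bsub>global \<XX>\<^esub>,
     add = germ_op \<XX> x ring.add \<rparr>"

text \<open>Length of a ring as a module over itself, whose submodules are the ideals.\<close>

definition ring_length :: "'r ring \<Rightarrow> enat" where
  "ring_length R = Sup {enat n | n. \<exists>I :: nat \<Rightarrow> 'r set.
     (\<forall>i \<le> n. ideal (I i) R) \<and> (\<forall>i < n. I i \<subset> I (Suc i))}"

definition krull_dim :: "'r ring \<Rightarrow> enat" where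
  "krull_dim R = Sup {enat n | n. \<exists>I :: nat \<Rightarrow> 'r set.
     (\<forall>i \<le> n. primeideal (I i) R) \<and> (\<forall>i < n. I i \<subset> I (Suc i))}"

definition regular_local_ring :: "'r ring \<Rightarrow> bool" where
  "regular_local_ring R \<longleftrightarrow> cring R \<and> noetherian_ring R \<and>
     (\<exists>!I. maximalideal I R) \<and>
     (\<exists>G \<subseteq> carrier R. finite G \<and> enat (card G) = krull_dim R \<and> maximalideal (genideal R G) R)"

definition regular_scheme :: "'u ringed_space \<Rightarrow> bool" where
  "regular_scheme \<XX> \<longleftrightarrow> (\<forall>x \<in> space \<XX>. regular_local_ring (stalk \<XX> x))"

definition generic_point :: "'u ringed_space \<Rightarrow> 'u set \<Rightarrow> 'u" where
  "generic_point \<XX> Z = (THE z. z \<in> space \<XX> \<and> Top \<XX> closure_of {z} = Z)"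

definition multiplicity :: "'u ringed_space \<Rightarrow> 'u set \<Rightarrow> enat" where
  "multiplicity \<XX> Z = ring_length (stalk \<XX> (generic_point \<XX> Z))"

definition min_multiplicity :: "'u ringed_space \<Rightarrow> enat" where
  "min_multiplicity \<XX> = (INF Z \<in> irreducible_components \<XX>. multiplicity \<XX> Z)"


subsection \<open>Properties of morphisms\<close>

definition locally_finite_type ::
  "'u ringed_space \<Rightarrow> 'u ringed_space \<Rightarrow> 'u morph \<Rightarrow> bool" where
  "locally_finite_type \<XX> Y f \<longleftrightarrow>
     (\<forall>U V. affine_open \<XX> U \<and> affine_open Y V \<and> U \<subseteq> preim \<XX> f V \<longrightarrow>
        (\<exists>G \<subseteq> carrier (Sec \<XX> U). finite G \<and>
           generate_ring (Sec \<XX> U)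
             ((\<lambda>s. Res \<XX> (preim \<XX> f V) U (sh f V s)) ` carrier (Sec Y V) \<union> G)
           = carrier (Sec \<XX> U)))"

definition finite_type :: "'u ringed_space \<Rightarrow> 'u ringed_space \<Rightarrow> 'u morph \<Rightarrow> bool" where
  "finite_type \<XX> Y f \<longleftrightarrow> locally_finite_type \<XX> Y f \<and>
     (\<forall>V. affine_open Y V \<longrightarrow> compactin (Top \<XX>) (preim \<XX> f V))"

definition closed_immersion :: "'u ringed_space \<Rightarrow> 'u ringed_space \<Rightarrow> 'u morph \<Rightarrow> bool" where
  "closed_immersion \<XX> Y f \<longleftrightarrow> morphism \<XX> Y f \<and>
     (\<forall>V. affine_open Y V \<longrightarrow> affine_open \<XX> (preim \<XX> f V) \<and>
        sh f V ` carrier (Sec Y V) = carrier (Sec \<XX> (preim \<XX> f V)))"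

definition separated :: "'u ringed_space \<Rightarrow> 'u ringed_space \<Rightarrow> 'u morph \<Rightarrow> bool" where
  "separated \<XX> Y f \<longleftrightarrow>
     (\<forall>W p q d. fibre_product \<XX> \<XX> Y f f W p q \<and> morphism \<XX> W d \<and>
        eq_mor \<XX> \<XX> (comp_mor W p d) id_mor \<and> eq_mor \<XX> \<XX> (comp_mor W q d) id_mor \<longrightarrow>
        closed_immersion \<XX> W d)"

definition universally_closed :: "'u ringed_space \<Rightarrow> 'u ringed_space \<Rightarrow> 'u morph \<Rightarrow> bool" where
  "universally_closed \<XX> Y f \<longleftrightarrow>
     (\<forall>T g W p q. scheme T \<and> morphism T Y g \<and> fibre_product \<XX> T Y f g W p q \<longrightarrow>
        closed_map (Top W) (Top T) (pt q))"

definition proper :: "'u ringed_space \<Rightarrow> 'u ringed_space \<Rightarrow> 'u morph \<Rightarrow> bool" where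
  "proper \<XX> Y f \<longleftrightarrow> separated \<XX> Y f \<and> finite_type \<XX> Y f \<and> universally_closed \<XX> Y f"

text \<open>Flatness is automatic over a field, so smoothness is geometric regularity.\<close>

definition smooth_over_field :: "'u ringed_space \<Rightarrow> 'u ringed_space \<Rightarrow> 'u morph \<Rightarrow> bool" where
  "smooth_over_field \<XX> B f \<longleftrightarrow> locally_finite_type \<XX> B f \<and> geometrically regular_scheme \<XX> B f"

definition dominant :: "'u ringed_space \<Rightarrow> 'u ringed_space \<Rightarrow> 'u morph \<Rightarrow> bool" where
  "dominant \<XX> Y f \<longleftrightarrow> Top Y closure_of (pt f ` space \<XX>) = space Y"


section \<open>Standard fibrations\<close>

definition Spec_rat :: "'u ringed_space \<Rightarrow> bool" where
  "Spec_rat B \<longleftrightarrow> (\<exists>\<iota>. spectrum_of (ring_of_type_algebra :: rat ring) B \<iota>)"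

text \<open>
  The projective line over \<open>\<rat>\<close>, glued from two affine lines with coordinates \<open>t\<close> and \<open>u\<close> along
  \<open>t u = 1\<close>. A ring has at most one homomorphism from \<open>\<rat>\<close>, so the \<open>\<rat>\<close>-structure need not be mentioned
  in the charts.
\<close>

definition projective_line :: "'u ringed_space \<Rightarrow> bool" where
  "projective_line P \<longleftrightarrow> scheme P \<and>
     (\<exists>U0 U1 \<phi>0 \<phi>1. affine_open P U0 \<and> affine_open P U1 \<and> U0 \<union> U1 = space P \<and>
        \<phi>0 \<in> ring_iso (ring_of_type_algebra :: rat poly ring) (Sec P U0) \<and>
        \<phi>1 \<in> ring_iso (ring_of_type_algebra :: rat poly ring) (Sec P U1) \<and>
        (let t = \<phi>0 [:0, 1:]; u = \<phi>1 [:0, 1:]; V = U0 \<inter> U1 in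
           V = nonvanishing P U0 t \<and> V = nonvanishing P U1 u \<and>
           Res P U0 V t \<otimes>\<^bsub>Sec P V\<^esub> Res P U1 V u = \<one>\<^bsub>Sec P V\<^esub>))"

text \<open>\<open>B\<close> is the spectrum of \<open>\<rat>\<close>, and \<open>s\<close> is the structure morphism of \<open>\<XX>\<close>.\<close>

definition standard_fibration ::
  "'u ringed_space \<Rightarrow> 'u ringed_space \<Rightarrow> 'u morph \<Rightarrow> 'u ringed_space \<Rightarrow> 'u morph \<Rightarrow> bool" where
  "standard_fibration B \<XX> s P \<pi> \<longleftrightarrow>
     Spec_rat B \<and> projective_line P \<and>
     scheme \<XX> \<and> morphism \<XX> B s \<and> smooth_over_field \<XX> B s \<and> proper \<XX> B s \<and>
     geometrically irreducible_scheme \<XX> B s \<and>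
     morphism \<XX> P \<pi> \<and> dominant \<XX> P \<pi> \<and>
     (\<forall>\<eta> F p S q. Top P closure_of {\<eta>} = space P \<and> fibre_at \<XX> P \<pi> \<eta> F p S q \<longrightarrow>
        geometrically integral_scheme F S q)"

definition closed_point :: "'u ringed_space \<Rightarrow> 'u \<Rightarrow> bool" where
  "closed_point \<XX> x \<longleftrightarrow> x \<in> space \<XX> \<and> closedin (Top \<XX>) {x}"


section \<open>Number fields\<close>

text \<open>The fixed algebraic closure of \<open>\<rat>\<close> is the type \<^typ>\<open>rat alg_closure\<close>.\<close>

abbreviation Qbar :: "rat alg_closure ring" where
  "Qbar \<equiv> ring_of_type_algebra"

definition number_field :: "rat alg_closure set \<Rightarrow> bool" where
  "number_field N \<longleftrightarrow> subfield N Qbar \<and> ring.finite_dimension Qbar (range to_ac) N"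

definition Gal :: "rat alg_closure set \<Rightarrow> (rat alg_closure \<Rightarrow> rat alg_closure) set" where
  "Gal N = {\<sigma> \<in> ring_iso Qbar Qbar. \<forall>x \<in> N. \<sigma> x = x}"

definition normal_over_rat :: "rat alg_closure set \<Rightarrow> bool" where
  "normal_over_rat M \<longleftrightarrow> subfield M Qbar \<and>
     (\<forall>f :: rat poly. Factorial_Ring.irreducible f \<and> (\<exists>x \<in> M. poly (map_poly to_ac f) x = 0) \<longrightarrow>
        {x. poly (map_poly to_ac f) x = 0} \<subseteq> M)"

definition normal_closure :: "rat alg_closure set \<Rightarrow> rat alg_closure set" where
  "normal_closure E = \<Inter>{M. normal_over_rat M \<and> E \<subseteq> M}"


section \<open>Geometric components of a fibre\<close>

text \<open>
  A fibre \<open>Fib\<close>, regarded as a \<open>\<rat>\<close>-scheme, together with its base change \<open>GFib\<close> to the algebraic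
  closure of \<open>\<rat>\<close>. All these objects are determined up to unique isomorphism.
\<close>

record 'u geometric_fibre =
  SpecQ :: "'u ringed_space"
  SpecQbar :: "'u ringed_space"
  coord :: "rat alg_closure \<Rightarrow> 'u"
  base_map :: "'u morph"
  Fib :: "'u ringed_space"
  structure_map :: "'u morph"
  GFib :: "'u ringed_space"
  to_Fib :: "'u morph"
  to_SpecQbar :: "'u morph"

definition geometric_fibre_at ::
  "'u ringed_space \<Rightarrow> 'u ringed_space \<Rightarrow> 'u morph \<Rightarrow> 'u ringed_space \<Rightarrow> 'u morph \<Rightarrow> 'u \<Rightarrow>
   'u geometric_fibre \<Rightarrow> bool" where
  "geometric_fibre_at B \<XX> s P \<pi> D \<F> \<longleftrightarrow>
     SpecQ \<F> = B \<and>
     (\<exists>p S q. fibre_at \<XX> P \<pi> D (Fib \<F>) p S q \<and>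
        eq_mor (Fib \<F>) B (structure_map \<F>) (comp_mor \<XX> s p)) \<and>
     morphism (Fib \<F>) B (structure_map \<F>) \<and>
     spectrum_of Qbar (SpecQbar \<F>) (coord \<F>) \<and>
     morphism (SpecQbar \<F>) B (base_map \<F>) \<and>
     fibre_product (Fib \<F>) (SpecQbar \<F>) B (structure_map \<F>) (base_map \<F>)
       (GFib \<F>) (to_Fib \<F>) (to_SpecQbar \<F>)"

text \<open>The set \<open>S\<^sub>D\<close>; \<^term>\<open>min_multiplicity (Fib \<F>)\<close> is \<open>m\<^sub>D\<close>.\<close>

definition S_comps :: "'u geometric_fibre \<Rightarrow> 'u set set" where
  "S_comps \<F> = {Z \<in> irreducible_components (GFib \<F>).
     multiplicity (GFib \<F>) Z = min_multiplicity (Fib \<F>)}"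

text \<open>
  \<open>\<sigma>\<close> acts on \<open>GFib\<close> by the automorphism \<open>h\<close> which is the identity on \<open>Fib\<close> and is induced by \<open>\<sigma>\<inverse>\<close>
  on coefficients; the inverse makes this a left action.
\<close>

definition galois_mor ::
  "'u geometric_fibre \<Rightarrow> (rat alg_closure \<Rightarrow> rat alg_closure) \<Rightarrow> 'u morph \<Rightarrow> bool" where
  "galois_mor \<F> \<sigma> h \<longleftrightarrow>
     morphism (GFib \<F>) (GFib \<F>) h \<and>
     eq_mor (GFib \<F>) (Fib \<F>) (comp_mor (GFib \<F>) (to_Fib \<F>) h) (to_Fib \<F>) \<and>
     (\<exists>g. spec_map (SpecQbar \<F>) (coord \<F>) Qbar (SpecQbar \<F>) (coord \<F>) (inv_into UNIV \<sigma>) g \<and>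
        eq_mor (GFib \<F>) (SpecQbar \<F>) (comp_mor (GFib \<F>) (to_SpecQbar \<F>) h)
          (comp_mor (SpecQbar \<F>) g (to_SpecQbar \<F>)))"

definition galois_act ::
  "'u geometric_fibre \<Rightarrow> (rat alg_closure \<Rightarrow> rat alg_closure) \<Rightarrow> 'u set \<Rightarrow> 'u set" where
  "galois_act \<F> \<sigma> Z = pt (SOME h. galois_mor \<F> \<sigma> h) ` Z"

text \<open>
  A closed subset \<open>Z\<close> of \<open>GFib\<close> is defined over \<open>E\<close> if it is the preimage of a closed subset \<open>Z0\<close> of
  the base change \<open>F'\<close> of \<open>Fib\<close> to \<open>E\<close>.
\<close>

definition defined_over :: "'u geometric_fibre \<Rightarrow> rat alg_closure set \<Rightarrow> 'u set \<Rightarrow> bool" where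
  "defined_over \<F> E Z \<longleftrightarrow> subfield E Qbar \<and>
     (\<exists>S \<iota> e b F' p q r Z0.
        spectrum_of (Qbar\<lparr>carrier := E\<rparr>) S \<iota> \<and>
        spec_map (SpecQbar \<F>) (coord \<F>) (Qbar\<lparr>carrier := E\<rparr>) S \<iota> id e \<and>
        morphism S (SpecQ \<F>) b \<and>
        fibre_product (Fib \<F>) S (SpecQ \<F>) (structure_map \<F>) b F' p q \<and>
        morphism (GFib \<F>) F' r \<and>
        eq_mor (GFib \<F>) (Fib \<F>) (comp_mor F' p r) (to_Fib \<F>) \<and>
        eq_mor (GFib \<F>) S (comp_mor F' q r) (comp_mor (SpecQbar \<F>) e (to_SpecQbar \<F>)) \<and>
        closedin (Top F') Z0 \<and> Z = preim (GFib \<F>) r Z0)"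

text \<open>\<open>E\<close> is the smallest field over which all members of \<open>\<Z>\<close> are defined.\<close>

definition field_of_definition ::
  "'u geometric_fibre \<Rightarrow> 'u set set \<Rightarrow> rat alg_closure set \<Rightarrow> bool" where
  "field_of_definition \<F> \<Z> E \<longleftrightarrow>
     subfield E Qbar \<and> (\<forall>Z \<in> \<Z>. defined_over \<F> E Z) \<and>
     (\<forall>E'. subfield E' Qbar \<and> (\<forall>Z \<in> \<Z>. defined_over \<F> E' Z) \<longrightarrow> E \<subseteq> E')"

text \<open>
  ``The field of definition of the elements of \<open>S\<^sub>D\<close>'' has two readings: the field of definition of
  each single element, well defined up to conjugation when these fields are conjugate, and the
  smallest field over which all elements are defined. Both are admitted; the second makes sense for
  every \<open>S\<^sub>D\<close>.
\<close>

definition field_of_definition_of_comps ::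
  "'u geometric_fibre \<Rightarrow> rat alg_closure set \<Rightarrow> bool" where
  "field_of_definition_of_comps \<F> E \<longleftrightarrow> subfield E Qbar \<and>
     ((\<forall>Z \<in> S_comps \<F>. \<exists>\<sigma> \<in> Gal (range to_ac). field_of_definition \<F> {Z} (\<sigma> ` E)) \<or>
      field_of_definition \<F> (S_comps \<F>) E)"

text \<open>
  The finite group used here is the image of the Galois group in the permutations of \<open>S\<^sub>D\<close>; any
  other finite quotient through which the action factors gives the same ratio, as shown below.
\<close>

definition galois_image ::
  "'u geometric_fibre \<Rightarrow> rat alg_closure set \<Rightarrow> ('u set \<Rightarrow> 'u set) set" where
  "galois_image \<F> N = (\<lambda>\<sigma>. restrict (galois_act \<F> \<sigma>) (S_comps \<F>)) ` Gal N"

definition delta :: "'u geometric_fibre \<Rightarrow> rat alg_closure set \<Rightarrow> real" where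
  "delta \<F> N =
     real (card {\<gamma> \<in> galois_image \<F> N. \<exists>Z \<in> S_comps \<F>. \<gamma> Z = Z})
     / real (card (galois_image \<F> N))"

lemma delta_eq_finite_quotient:
  assumes act: "group_action \<Gamma> (S_comps \<F>) \<alpha>" and fin: "finite (carrier \<Gamma>)"
    and surj: "\<rho> ` Gal N = carrier \<Gamma>"
    and factors: "\<And>\<sigma> Z. \<sigma> \<in> Gal N \<Longrightarrow> Z \<in> S_comps \<F> \<Longrightarrow> \<alpha> (\<rho> \<sigma>) Z = galois_act \<F> \<sigma> Z"
  shows "delta \<F> N =
    real (card {\<gamma> \<in> carrier \<Gamma>. \<exists>Z \<in> S_comps \<F>. \<alpha> \<gamma> Z = Z}) / real (card (carrier \<Gamma>))"
proof -
  let ?S = "S_comps \<F>"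
  interpret group_action \<Gamma> ?S \<alpha> by fact
  interpret G: group \<Gamma> using group_hom group_hom.axioms(1) by blast
  have ext: "\<alpha> g \<in> extensional ?S" if "g \<in> carrier \<Gamma>" for g
    using bij_prop0[OF that] by (simp add: Bij_def)
  have img: "galois_image \<F> N = \<alpha> ` carrier \<Gamma>"
  proof -
    have "restrict (galois_act \<F> \<sigma>) ?S = \<alpha> (\<rho> \<sigma>)" if \<sigma>: "\<sigma> \<in> Gal N" for \<sigma>
    proof
      fix Z
      have "\<rho> \<sigma> \<in> carrier \<Gamma>" using \<sigma> surj by blast
      from ext[OF this] show "restrict (galois_act \<F> \<sigma>) ?S Z = \<alpha> (\<rho> \<sigma>) Z"
        using factors[OF \<sigma>, of Z] by (cases "Z \<in> ?S") (auto simp: extensional_def)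
    qed
    then show ?thesis
      unfolding galois_image_def surj[symmetric] by (auto simp: image_image)
  qed
  define K where "K = {k \<in> carrier \<Gamma>. \<alpha> k = \<alpha> \<one>\<^bsub>\<Gamma>\<^esub>}"
  have finK: "finite K" unfolding K_def using fin by simp
  have K0: "card K > 0" using finK by (auto simp: K_def card_gt_0_iff)
  have mult: "\<alpha> (g \<otimes>\<^bsub>\<Gamma>\<^esub> h) = compose ?S (\<alpha> g) (\<alpha> h)"
    if "g \<in> carrier \<Gamma>" "h \<in> carrier \<Gamma>" for g h
    using group_hom.hom_mult[OF group_hom that] that bij_prop0 by (simp add: BijGroup_def)
  have fibre: "card {h \<in> carrier \<Gamma>. \<alpha> h = \<alpha> g} = card K" if g: "g \<in> carrier \<Gamma>" for g
  proof (rule bij_betw_same_card[symmetric], rule bij_betw_byWitness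
      [where f = "\<lambda>k. g \<otimes>\<^bsub>\<Gamma>\<^esub> k" and f' = "\<lambda>h. inv\<^bsub>\<Gamma>\<^esub> g \<otimes>\<^bsub>\<Gamma>\<^esub> h"])
    show "\<forall>k \<in> K. inv\<^bsub>\<Gamma>\<^esub> g \<otimes>\<^bsub>\<Gamma>\<^esub> (g \<otimes>\<^bsub>\<Gamma>\<^esub> k) = k"
      using g by (auto simp: K_def G.m_assoc[symmetric])
    show "\<forall>h \<in> {h \<in> carrier \<Gamma>. \<alpha> h = \<alpha> g}. g \<otimes>\<^bsub>\<Gamma>\<^esub> (inv\<^bsub>\<Gamma>\<^esub> g \<otimes>\<^bsub>\<Gamma>\<^esub> h) = h"
      using g by (auto simp: G.m_assoc[symmetric])
    show "(\<lambda>k. g \<otimes>\<^bsub>\<Gamma>\<^esub> k) ` K \<subseteq> {h \<in> carrier \<Gamma>. \<alpha> h = \<alpha> g}"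
    proof safe
      fix k assume k: "k \<in> K"
      then show "g \<otimes>\<^bsub>\<Gamma>\<^esub> k \<in> carrier \<Gamma>" using g by (simp add: K_def)
      have "\<alpha> (g \<otimes>\<^bsub>\<Gamma>\<^esub> k) = \<alpha> (g \<otimes>\<^bsub>\<Gamma>\<^esub> \<one>\<^bsub>\<Gamma>\<^esub>)"
        using k mult[OF g, of k] mult[OF g G.one_closed] unfolding K_def mem_Collect_eq by argo
      then show "\<alpha> (g \<otimes>\<^bsub>\<Gamma>\<^esub> k) = \<alpha> g" using g by simp
    qed
    show "(\<lambda>h. inv\<^bsub>\<Gamma>\<^esub> g \<otimes>\<^bsub>\<Gamma>\<^esub> h) ` {h \<in> carrier \<Gamma>. \<alpha> h = \<alpha> g} \<subseteq> K"
    proof safe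
      fix h assume h: "h \<in> carrier \<Gamma>" "\<alpha> h = \<alpha> g"
      have "\<alpha> (inv\<^bsub>\<Gamma>\<^esub> g \<otimes>\<^bsub>\<Gamma>\<^esub> h) = \<alpha> (inv\<^bsub>\<Gamma>\<^esub> g \<otimes>\<^bsub>\<Gamma>\<^esub> g)"
        using h mult[OF G.inv_closed[OF g] h(1)] mult[OF G.inv_closed[OF g] g] by argo
      then show "inv\<^bsub>\<Gamma>\<^esub> g \<otimes>\<^bsub>\<Gamma>\<^esub> h \<in> K" using g h by (simp add: K_def)
    qed
  qed
  have count: "card {h \<in> carrier \<Gamma>. Q (\<alpha> h)} = card {\<gamma> \<in> \<alpha> ` carrier \<Gamma>. Q \<gamma>} * card K" for Q
  proof -
    have "{h \<in> carrier \<Gamma>. Q (\<alpha> h)}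
        = (\<Union>\<gamma> \<in> {\<gamma> \<in> \<alpha> ` carrier \<Gamma>. Q \<gamma>}. {h \<in> carrier \<Gamma>. \<alpha> h = \<gamma>})"
      by auto
    also have "card \<dots> = (\<Sum>\<gamma> \<in> {\<gamma> \<in> \<alpha> ` carrier \<Gamma>. Q \<gamma>}. card {h \<in> carrier \<Gamma>. \<alpha> h = \<gamma>})"
      using fin by (intro card_UN_disjoint) auto
    also have "\<dots> = (\<Sum>\<gamma> \<in> {\<gamma> \<in> \<alpha> ` carrier \<Gamma>. Q \<gamma>}. card K)"
      by (intro sum.cong) (auto simp: fibre)
    finally show ?thesis by simp
  qed
  show ?thesis
    using count[of "\<lambda>_. True"] count[of "\<lambda>\<gamma>. \<exists>Z \<in> ?S. \<gamma> Z = Z"] K0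
    by (simp add: delta_def img)
qed

end

theory Submission
  imports Defs
begin

text \<open>
  Let \<open>M\<close> be the normal closure of \<open>E\<close>. Every member of \<open>S\<^sub>D\<close> is defined over a subfield of \<open>M\<close>, so
  automorphisms over \<open>M\<close> act trivially on \<open>S\<^sub>D\<close>. As \<open>M\<close> is normal, the field \<open>N\<close> is linearly disjoint
  from \<open>M\<close> over \<open>N \<inter> M\<close>, so every automorphism over \<open>N \<inter> M\<close> agrees on \<open>M\<close> with one over \<open>N\<close>. Hence
  the Galois groups of \<open>N\<close> and of \<open>N \<inter> M\<close> have the same image in the permutations of \<open>S\<^sub>D\<close>. Linear
  disjointness is proved by Artin's argument, without assuming that \<open>M\<close> is finite over \<open>\<rat>\<close>: that would
  need a finiteness property of the fibre, and it can fail when \<open>S\<^sub>D\<close> is empty.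
\<close>


section \<open>Partial embeddings of an algebraic closure\<close>

text \<open>The weight lies on the agreement on \<open>M\<close>. Given \<sigma> over
  \<open>N \<inter> M\<close>, the only candidate on the ring generated by \<open>M\<close> and
  \<open>N\<close> sends \<open>m * n\<close> to \<open>\<sigma> m * n\<close>, and linear
  disjointness is what makes it well defined. The candidate has to be written down before it is
  known to be a map, on a domain not known to be a field. Hence homomorphisms appear as graphs, and
  their extension to the whole algebraic closure is proved for subrings, with pseudo-division in
  place of division. On the geometric side, \<sigma> acts through an arbitrarily chosen endomorphism
  of \<open>GFib\<close>, and morphisms are determined only up to \<open>eq_mor\<close>.
  Multiplicativity of the action and its triviality on a set defined over a field \<open>K\<close>
  both rest on uniqueness in a universal property: that of \<open>GFib\<close> in the first case,
  that of the base change of \<open>Fib\<close> to \<open>K\<close> in the second.\<close>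

text \<open>
  A homomorphism defined on a subring is represented by its graph \<open>G\<close>; given the other
  conditions, the last one makes the relation single-valued.
\<close>

definition partial_embedding :: "('k :: field alg_closure \<times> 'k alg_closure) set \<Rightarrow> bool" where
  "partial_embedding G \<longleftrightarrow>
     (\<forall>c. (to_ac c, to_ac c) \<in> G) \<and>
     (\<forall>a b c d. (a, b) \<in> G \<and> (c, d) \<in> G \<longrightarrow> (a + c, b + d) \<in> G \<and> (a * c, b * d) \<in> G) \<and>
     (\<forall>b. (0, b) \<in> G \<longrightarrow> b = 0)"

lemma partial_embedding_const: "partial_embedding G \<Longrightarrow> (to_ac q, to_ac q) \<in> G"
  and partial_embedding_add: "partial_embedding G \<Longrightarrow> (a, b) \<in> G \<Longrightarrow> (c, d) \<in> G \<Longrightarrow> (a + c, b + d) \<in> G"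
  and partial_embedding_mult: "partial_embedding G \<Longrightarrow> (a, b) \<in> G \<Longrightarrow> (c, d) \<in> G \<Longrightarrow> (a * c, b * d) \<in> G"
  and partial_embedding_zero_left: "partial_embedding G \<Longrightarrow> (0, b) \<in> G \<Longrightarrow> b = 0"
  by (auto simp: partial_embedding_def)

lemma partial_embedding_zero: "partial_embedding G \<Longrightarrow> (0, 0) \<in> G"
  using partial_embedding_const[of G 0] by simp

lemma partial_embedding_uminus:
  assumes "partial_embedding G" "(a, b) \<in> G"
  shows "(- a, - b) \<in> G"
  using partial_embedding_mult[OF assms(1) partial_embedding_const[OF assms(1), of "-1"] assms(2)]
  by simp

lemma partial_embedding_diff:
  assumes "partial_embedding G" "(a, b) \<in> G" "(c, d) \<in> G"
  shows "(a - c, b - d) \<in> G"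
  using partial_embedding_add[OF assms(1,2) partial_embedding_uminus[OF assms(1,3)]] by simp

lemma partial_embedding_unique:
  assumes "partial_embedding G" "(a, b) \<in> G" "(a, c) \<in> G"
  shows "b = c"
  using partial_embedding_diff[OF assms] partial_embedding_zero_left[OF assms(1)] by fastforce

lemma partial_embedding_sum:
  assumes "partial_embedding G" "\<And>i. i \<in> I \<Longrightarrow> (f i, g i) \<in> G"
  shows "(sum f I, sum g I) \<in> G"
  using assms(2)
  by (induction I rule: infinite_finite_induct)
    (auto intro: partial_embedding_zero[OF assms(1)] partial_embedding_add[OF assms(1)])

text \<open>Stands for applying the homomorphism with graph \<open>G\<close> to the coefficients of
  \<open>p\<close>, with result \<open>r\<close>.\<close>

definition rel_poly ::
  "('k :: field alg_closure \<times> 'k alg_closure) set \<Rightarrow> 'k alg_closure poly \<Rightarrow> 'k alg_closure poly \<Rightarrow> bool" where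
  "rel_poly G p r \<longleftrightarrow> (\<forall>i. (Polynomial.coeff p i, Polynomial.coeff r i) \<in> G)"

lemma rel_poly_map_poly: "partial_embedding G \<Longrightarrow> rel_poly G (map_poly to_ac p) (map_poly to_ac p)"
  by (simp add: rel_poly_def coeff_map_poly partial_embedding_const)

lemma rel_poly_add:
  assumes "partial_embedding G" "rel_poly G p r" "rel_poly G q s"
  shows "rel_poly G (p + q) (r + s)"
  using assms by (simp add: rel_poly_def partial_embedding_add)

lemma rel_poly_diff:
  assumes "partial_embedding G" "rel_poly G p r" "rel_poly G q s"
  shows "rel_poly G (p - q) (r - s)"
  using assms by (simp add: rel_poly_def partial_embedding_diff)

lemma rel_poly_mult:
  assumes "partial_embedding G" "rel_poly G p r" "rel_poly G q s"
  shows "rel_poly G (p * q) (r * s)"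
  using assms unfolding rel_poly_def coeff_mult
  by (auto intro!: partial_embedding_sum partial_embedding_mult)

lemma rel_poly_smult:
  assumes "partial_embedding G" "(a, b) \<in> G" "rel_poly G q s"
  shows "rel_poly G (Polynomial.smult a q) (Polynomial.smult b s)"
  using assms by (simp add: rel_poly_def partial_embedding_mult)

lemma rel_poly_monom:
  assumes "partial_embedding G" "(a, b) \<in> G"
  shows "rel_poly G (Polynomial.monom a n) (Polynomial.monom b n)"
  using assms by (simp add: rel_poly_def partial_embedding_zero)

lemma rel_poly_eval:
  assumes "partial_embedding G" "rel_poly G p r" "(x, y) \<in> G"
  shows "(poly p x, poly r y) \<in> G"
proof -
  \<comment> \<open>Equality of the two degrees needs injectivity, whose proof rests on this lemma;
    so both sums run to the larger degree.\<close>
  let ?n = "max (Polynomial.degree p) (Polynomial.degree r)"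
  have pow: "(x ^ i, y ^ i) \<in> G" for i
    by (induction i)
      (use partial_embedding_const[OF assms(1), of 1] in
        \<open>auto intro: partial_embedding_mult[OF assms(1)] assms(3)\<close>)
  have *: "poly q z = (\<Sum>i\<le>?n. Polynomial.coeff q i * z ^ i)"
    if "Polynomial.degree q \<le> ?n" for q :: "'a alg_closure poly" and z
    unfolding poly_altdef using that
    by (intro sum.mono_neutral_left) (auto simp: coeff_eq_0 not_le)
  show ?thesis
    unfolding *[of p, simplified] *[of r, simplified]
    by (rule partial_embedding_sum[OF assms(1)])
      (use assms(2) in \<open>auto simp: rel_poly_def intro!: partial_embedding_mult[OF assms(1)] pow\<close>)
qed

lemma map_poly_to_ac_eq_0_iff [simp]: "map_poly to_ac p = 0 \<longleftrightarrow> p = 0"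
  by (simp add: poly_eq_iff coeff_map_poly)

text \<open>Constants are related to themselves, so the values of \<open>p\<close> at related points
  are related, and 0 is related only to 0.\<close>

lemma partial_embedding_root:
  assumes "partial_embedding G" "(a, b) \<in> G" "poly (map_poly to_ac p) a = 0"
  shows "poly (map_poly to_ac p) b = 0"
  using rel_poly_eval[OF assms(1) rel_poly_map_poly[OF assms(1)] assms(2), of p] assms
    partial_embedding_zero_left by metis

text \<open>A nonzero algebraic element is a root of a polynomial with nonzero constant term.\<close>

lemma partial_embedding_zero_right:
  assumes G: "partial_embedding G" "(a, 0) \<in> G"
  shows "a = 0"
proof (rule ccontr)
  assume a: "a \<noteq> 0"
  obtain p where p: "p \<noteq> 0" "poly (map_poly to_ac p) a = 0"
    by (rule alg_closure_algebraic)
  define n where "n = (LEAST n. \<exists>p. p \<noteq> 0 \<and> poly (map_poly to_ac p) a = 0 \<and> Polynomial.degree p = n)"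
  have "\<exists>p. p \<noteq> 0 \<and> poly (map_poly to_ac p) a = 0 \<and> Polynomial.degree p = n"
    unfolding n_def by (rule LeastI[of _ "Polynomial.degree p"]) (use p in auto)
  then obtain q where q: "q \<noteq> 0" "poly (map_poly to_ac q) a = 0" "Polynomial.degree q = n"
    by blast
  have "poly (map_poly to_ac q) 0 = 0"
    by (rule partial_embedding_root[OF G q(2)])
  then have "Polynomial.coeff q 0 = 0"
    by (simp add: poly_0_coeff_0 coeff_map_poly)
  then obtain q' where q': "q = pCons 0 q'"
    by (metis pCons_cases coeff_pCons_0)
  with q a have "q' \<noteq> 0" "poly (map_poly to_ac q') a = 0"
    by (auto simp: map_poly_pCons)
  then have "n \<le> Polynomial.degree q'"
    unfolding n_def by (intro Least_le) auto
  with q q' \<open>q' \<noteq> 0\<close> show False by simp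
qed

section \<open>Extension of partial embeddings\<close>

lemma rel_poly_degree:
  assumes "partial_embedding G" "rel_poly G p r"
  shows "Polynomial.degree p = Polynomial.degree r"
proof -
  have "Polynomial.coeff p i = 0 \<longleftrightarrow> Polynomial.coeff r i = 0" for i
    using assms partial_embedding_zero_left partial_embedding_zero_right
    unfolding rel_poly_def by metis
  then show ?thesis by (simp add: degree_def)
qed

text \<open>The extension of an embedding to a simple extension, over a domain that is only a ring.
  The new graph pairs \<open>poly p x\<close> with \<open>poly r y\<close> for corresponding
  \<open>p\<close> and \<open>r\<close>; it is single-valued once \<open>poly p x = 0\<close> forces
  \<open>poly r y = 0\<close>, which follows by reducing \<open>p\<close> modulo \<open>f\<close>.
  The root \<open>y\<close> is left free, so that an element can later be sent to a different
  conjugate.\<close>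

lemma partial_embedding_extend_root:
  assumes G: "partial_embedding G"
    and f: "rel_poly G f f'" "f \<noteq> 0" "poly f x = 0"
    and minimal: "\<And>p r. rel_poly G p r \<Longrightarrow> p \<noteq> 0 \<Longrightarrow> poly p x = 0 \<Longrightarrow>
      Polynomial.degree f \<le> Polynomial.degree p"
    and y: "poly f' y = 0"
  shows "\<exists>H. partial_embedding H \<and> G \<subseteq> H \<and> (x, y) \<in> H"
proof -
  let ?lc = "lead_coeff f" and ?lc' = "lead_coeff f'"
  have lc: "(?lc, ?lc') \<in> G"
    using f(1) rel_poly_degree[OF G f(1)] by (simp add: rel_poly_def)
  have lc'0: "?lc' \<noteq> 0"
    using partial_embedding_zero_right[OF G] lc f(2) by fastforce
  have root: "poly r y = 0" if "rel_poly G p r" "poly p x = 0" for p r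
    using that
  proof (induction "Polynomial.degree p" arbitrary: p r rule: less_induct)
    case less
    show ?case
    proof (cases "p = 0")
      case True
      then have "Polynomial.coeff r i = 0" for i
        using less.prems(1) partial_embedding_zero_left[OF G] by (simp add: rel_poly_def)
      then show ?thesis by (simp add: poly_altdef)
    next
      case False
      note dp = minimal[OF less.prems(1) False less.prems(2)]
      note deg = rel_poly_degree[OF G less.prems(1)] rel_poly_degree[OF G f(1)]
      define n where "n = Polynomial.degree p - Polynomial.degree f"
      \<comment> \<open>One step of pseudo-division by \<open>f\<close>: multiplying
        \<open>p\<close> by \<open>lead_coeff f\<close> avoids inverses, which the domain of
        \<open>G\<close> may lack. The same step on the other side gives the polynomial
        \<open>s\<close> corresponding to \<open>q\<close>.\<close>
      define q where "q = Polynomial.smult ?lc p - Polynomial.monom (lead_coeff p) n * f"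
      define s where "s = Polynomial.smult ?lc' r - Polynomial.monom (lead_coeff r) n * f'"
      have lcp: "(lead_coeff p, lead_coeff r) \<in> G"
        using less.prems(1) deg by (simp add: rel_poly_def)
      have qs: "rel_poly G q s"
        unfolding q_def s_def
        by (intro rel_poly_diff rel_poly_smult rel_poly_mult rel_poly_monom G lc lcp f less.prems)
      have qx: "poly q x = 0"
        by (simp add: q_def less.prems f(3))
      have sy: "poly s y = ?lc' * poly r y"
        by (simp add: s_def y)
      show ?thesis
      proof (cases "Polynomial.degree q < Polynomial.degree p")
        case True
        from less.hyps[OF this qs qx] sy lc'0 show ?thesis by simp
      next
        case False
        \<comment> \<open>The leading terms cancel, so the degree can fail to drop only if
          \<open>q = 0\<close>, and then \<open>s = 0\<close> as well.\<close>
        have "Polynomial.degree (Polynomial.monom (lead_coeff p) n * f) \<le> Polynomial.degree p"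
          using degree_mult_le[of "Polynomial.monom (lead_coeff p) n" f]
            degree_monom_le[of "lead_coeff p" n] dp by (simp add: n_def)
        then have "Polynomial.degree q \<le> Polynomial.degree p"
          unfolding q_def by (intro degree_diff_le) auto
        moreover have "Polynomial.coeff q (Polynomial.degree p) = 0"
          using dp by (simp add: q_def coeff_monom_mult n_def)
        ultimately have "q = 0"
          using False leading_coeff_0_iff[of q] by simp
        then have "Polynomial.coeff s i = 0" for i
          using qs partial_embedding_zero_left[OF G] by (simp add: rel_poly_def)
        then have "poly s y = 0" by (simp add: poly_altdef)
        then show ?thesis using sy lc'0 by simp
      qed
    qed
  qed
  define H where "H = {(poly p x, poly r y) | p r. rel_poly G p r}"
  have "partial_embedding H"
    unfolding partial_embedding_def
  proof (intro conjI allI impI)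
    fix c :: 'a
    show "(to_ac c, to_ac c) \<in> H"
      unfolding H_def using rel_poly_map_poly[OF G, of "[:c:]"]
      by (auto intro!: exI[of _ "map_poly to_ac [:c:]"] simp: map_poly_pCons)
  next
    fix a b c d assume "(a, b) \<in> H \<and> (c, d) \<in> H"
    then obtain p r q s where "rel_poly G p r" "rel_poly G q s"
      "a = poly p x" "b = poly r y" "c = poly q x" "d = poly s y"
      by (auto simp: H_def)
    then show "(a + c, b + d) \<in> H" "(a * c, b * d) \<in> H"
      using rel_poly_add[OF G] rel_poly_mult[OF G] unfolding H_def
      by (force intro: poly_add[symmetric] poly_mult[symmetric])+
  next
    fix b assume "(0, b) \<in> H"
    then show "b = 0" using root by (auto simp: H_def)
  qed
  moreover have "G \<subseteq> H"
  proof clarify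
    fix a b assume "(a, b) \<in> G"
    then have "rel_poly G [:a:] [:b:]"
      using partial_embedding_zero[OF G] by (auto simp: rel_poly_def coeff_pCons split: nat.split)
    then show "(a, b) \<in> H"
      unfolding H_def by (force intro: exI[of _ "[:a:]"] exI[of _ "[:b:]"])
  qed
  moreover have "(x, y) \<in> H"
  proof -
    have "rel_poly G (Polynomial.monom 1 1) (Polynomial.monom 1 1)"
      using rel_poly_monom[OF G, of 1 1 1] partial_embedding_const[OF G, of 1] by simp
    then show ?thesis
      unfolding H_def by (force simp: poly_monom)
  qed
  ultimately show ?thesis by blast
qed

text \<open>A substitute for the minimal polynomial of \<open>x\<close> over the domain of
  \<open>G\<close>: of least degree, but not necessarily monic. Candidates exist because
  \<open>x\<close> is algebraic over the base field.\<close>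

lemma minimal_rel_poly:
  fixes G :: "('k :: field alg_closure \<times> 'k alg_closure) set"
  assumes "partial_embedding G"
  obtains f f' where "rel_poly G f f'" "f \<noteq> 0" "poly f x = 0"
    "\<And>p r. rel_poly G p r \<Longrightarrow> p \<noteq> 0 \<Longrightarrow> poly p x = 0 \<Longrightarrow> Polynomial.degree f \<le> Polynomial.degree p"
proof -
  let ?P = "\<lambda>(p, r). rel_poly G p r \<and> p \<noteq> 0 \<and> poly p x = 0"
  obtain p :: "'k poly" where "p \<noteq> 0" "poly (map_poly to_ac p) x = 0"
    by (rule alg_closure_algebraic)
  then have "?P (map_poly to_ac p, map_poly to_ac p)"
    by (simp add: rel_poly_map_poly assms)
  from ex_has_least_nat[of ?P, OF this, of "\<lambda>z. Polynomial.degree (fst z)"]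
  obtain f f' where "?P (f, f')" "\<And>p r. ?P (p, r) \<Longrightarrow> Polynomial.degree f \<le> Polynomial.degree p"
    by force
  then show ?thesis using that by auto
qed

lemma degree_pos_of_root:
  assumes "f \<noteq> 0" "poly f x = 0"
  shows "Polynomial.degree f > 0"
  using assms by (auto intro!: gr0I elim!: degree_eq_zeroE)

lemma partial_embedding_extend:
  fixes G :: "('k :: field alg_closure \<times> 'k alg_closure) set"
  assumes G: "partial_embedding G"
  shows "\<exists>H y. partial_embedding H \<and> G \<subseteq> H \<and> (x, y) \<in> H"
proof -
  obtain f f' where f: "rel_poly G f f'" "f \<noteq> 0" "poly f x = 0"
    "\<And>p r. rel_poly G p r \<Longrightarrow> p \<noteq> 0 \<Longrightarrow> poly p x = 0 \<Longrightarrow> Polynomial.degree f \<le> Polynomial.degree p"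
    using minimal_rel_poly[OF G] by blast
  have "Polynomial.degree f' > 0"
    using degree_pos_of_root[OF f(2,3)] rel_poly_degree[OF G f(1)] by simp
  then obtain y where "poly f' y = 0"
    using alg_closed_imp_poly_has_root by blast
  then have "\<exists>H. partial_embedding H \<and> G \<subseteq> H \<and> (x, y) \<in> H"
    by (intro partial_embedding_extend_root[OF G f(1-3)]) (use f(4) in auto)
  then show ?thesis by blast
qed

text \<open>A graph that is maximal by Zorn's lemma is total, since any \<open>x\<close> can be
  adjoined. Surjectivity comes from algebraicity: an injective map that sends the finite root set of
  a polynomial over the base field into itself permutes it, and every element lies in such a
  set.\<close>

lemma partial_embedding_extends_to_automorphism:
  fixes G :: "('k :: field alg_closure \<times> 'k alg_closure) set"
  assumes G: "partial_embedding G"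
  obtains \<sigma> where "\<sigma> \<in> ring_iso ring_of_type_algebra ring_of_type_algebra"
    "\<And>a b. (a, b) \<in> G \<Longrightarrow> \<sigma> a = b"
proof -
  define \<A> where "\<A> = {H. partial_embedding H \<and> G \<subseteq> H}"
  have "\<exists>M\<in>\<A>. \<forall>H\<in>\<A>. M \<subseteq> H \<longrightarrow> H = M"
  proof (rule subset_Zorn_nonempty)
    show "\<A> \<noteq> {}" using G by (auto simp: \<A>_def)
  next
    fix \<C> assume \<C>: "\<C> \<noteq> {}" "subset.chain \<A> \<C>"
    then have emb: "partial_embedding H" "G \<subseteq> H" if "H \<in> \<C>" for H
      using that by (auto simp: subset.chain_def \<A>_def)
    have join: "\<exists>H\<in>\<C>. u \<in> H \<and> v \<in> H" if "u \<in> \<Union>\<C>" "v \<in> \<Union>\<C>" for u v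
    proof -
      obtain H K where HK: "H \<in> \<C>" "u \<in> H" "K \<in> \<C>" "v \<in> K" using \<open>u \<in> \<Union>\<C>\<close> \<open>v \<in> \<Union>\<C>\<close> by blast
      with \<C>(2) have "H \<subseteq> K \<or> K \<subseteq> H" by (auto simp: subset_chain_def)
      with HK show ?thesis by blast
    qed
    have "partial_embedding (\<Union>\<C>)"
      unfolding partial_embedding_def
    proof (intro conjI allI impI)
      show "(to_ac c, to_ac c) \<in> \<Union>\<C>" for c
        using \<C>(1) emb(1) partial_embedding_const by blast
    next
      fix a b c d assume "(a, b) \<in> \<Union>\<C> \<and> (c, d) \<in> \<Union>\<C>"
      then obtain H where "H \<in> \<C>" "(a, b) \<in> H" "(c, d) \<in> H" using join by blast
      then show "(a + c, b + d) \<in> \<Union>\<C>" "(a * c, b * d) \<in> \<Union>\<C>"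
        using emb(1) partial_embedding_add partial_embedding_mult by blast+
    next
      show "b = 0" if "(0, b) \<in> \<Union>\<C>" for b
        using that emb(1) partial_embedding_zero_left by blast
    qed
    then show "\<Union>\<C> \<in> \<A>"
      using \<C>(1) emb(2) by (auto simp: \<A>_def)
  qed
  then obtain M where M: "partial_embedding M" "G \<subseteq> M"
    and max: "\<And>H. partial_embedding H \<Longrightarrow> M \<subseteq> H \<Longrightarrow> H = M"
    unfolding \<A>_def by (metis (no_types, lifting) mem_Collect_eq subset_trans)
  have total: "\<exists>y. (x, y) \<in> M" for x
    using partial_embedding_extend[OF M(1), of x] max by blast
  define \<sigma> where "\<sigma> x = (THE y. (x, y) \<in> M)" for x
  have eqI: "\<sigma> a = b" if "(a, b) \<in> M" for a b
    unfolding \<sigma>_def using that partial_embedding_unique[OF M(1)] by blast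
  have mem: "(x, \<sigma> x) \<in> M" for x
    using total[of x] eqI by blast
  have hom: "\<sigma> (x + y) = \<sigma> x + \<sigma> y" "\<sigma> (x * y) = \<sigma> x * \<sigma> y" "\<sigma> 1 = 1" for x y
    using mem eqI partial_embedding_add[OF M(1)] partial_embedding_mult[OF M(1)]
      partial_embedding_const[OF M(1), of 1] by (auto simp del: to_ac_1 simp flip: to_ac_1)
  have inj: "inj \<sigma>"
  proof (rule injI)
    fix x y assume "\<sigma> x = \<sigma> y"
    then have "(x - y, 0) \<in> M"
      using partial_embedding_diff[OF M(1) mem[of x] mem[of y]] by simp
    then show "x = y" using partial_embedding_zero_right[OF M(1)] by fastforce
  qed
  have "surj \<sigma>"
  proof (unfold surj_def, intro allI)
    fix b
    obtain p :: "'k poly" where p: "p \<noteq> 0" "poly (map_poly to_ac p) b = 0"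
      by (rule alg_closure_algebraic)
    let ?R = "{x. poly (map_poly to_ac p) x = 0}"
    have "finite ?R" using p(1) by (intro poly_roots_finite) simp
    moreover have "\<sigma> ` ?R \<subseteq> ?R"
      using partial_embedding_root[OF M(1) mem] by auto
    ultimately have "\<sigma> ` ?R = ?R"
      using inj by (meson card_image card_subset_eq inj_on_subset subset_UNIV)
    then show "\<exists>a. b = \<sigma> a" using p(2) by (metis (mono_tags) imageE mem_Collect_eq)
  qed
  with inj hom have "\<sigma> \<in> ring_iso ring_of_type_algebra ring_of_type_algebra"
    by (simp add: ring_iso_def ring_hom_def ring_of_type_algebra_def bij_def)
  then show ?thesis using that eqI M(2) by blast
qed



section \<open>Galois theory of the algebraic closure of the rational numbers\<close>

text \<open>The inclusion of the integers in the rationals is an epimorphism of rings: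
  \<open>f\<close> and \<open>g\<close> agree on integers, hence f(a/b) = f(a/b) g(b) g(1/b) =
  f(a/b) f(b) g(1/b) = g(a) g(1/b) = g(a/b). The target is an arbitrary ring because it will also be
  a ring of global sections.\<close>

lemma ring_hom_rat_unique:
  fixes R (structure)
  assumes "f \<in> ring_hom (ring_of_type_algebra :: rat ring) R"
    and "g \<in> ring_hom (ring_of_type_algebra :: rat ring) R"
    and "ring R"
  shows "f q = g q"
proof -
  interpret f: ring_hom_ring "ring_of_type_algebra :: rat ring" R f
    by (intro ring_hom_ringI2 assms ring_from_type_algebra)
  interpret g: ring_hom_ring "ring_of_type_algebra :: rat ring" R g
    by (intro ring_hom_ringI2 assms ring_from_type_algebra)
  have closed [simp]: "f x \<in> carrier R" "g x \<in> carrier R" for x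
    using f.hom_closed[of x] g.hom_closed[of x] by (simp_all add: ring_of_type_algebra_def)
  have f: "f (x + y) = f x \<oplus> f y" "f (x * y) = f x \<otimes> f y" "f 1 = \<one>" "f 0 = \<zero>"
    and g: "g (x + y) = g x \<oplus> g y" "g (x * y) = g x \<otimes> g y" "g 1 = \<one>" "g 0 = \<zero>" for x y
    using f.hom_add[of x y] f.hom_mult[of x y] f.hom_one f.hom_zero
      g.hom_add[of x y] g.hom_mult[of x y] g.hom_one g.hom_zero
    by (simp_all add: ring_of_type_algebra_def)
  have nat: "f (of_nat n) = g (of_nat n)" for n
    by (induction n) (simp_all add: f g)
  have int: "f (of_int k) = g (of_int k)" for k
  proof (cases k)
    case (neg n)
    have neg_eq: "h (- x) = \<ominus> h x"
      if "\<And>x y. h (x + y) = h x \<oplus> h y" "h 0 = \<zero>" "\<And>x. h x \<in> carrier R" for h :: "rat \<Rightarrow> _" and x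
      using that(1)[of "- x" x] that(2,3) by (intro f.S.minus_equality[symmetric]) auto
    show ?thesis
      using neg_eq[of f "of_nat (Suc n)", OF f(1,4) closed(1)]
        neg_eq[of g "of_nat (Suc n)", OF g(1,4) closed(2)] nat[of "Suc n"] neg
      by simp
  qed (simp add: nat)
  obtain a b where q: "q = of_int a / of_int b" "b \<noteq> 0"
    by (metis quotient_of_div quotient_of_denom_pos' less_irrefl surj_pair quotient_of_denom_pos)
  let ?b = "of_int b :: rat"
  have "f q = f q \<otimes> (g ?b \<otimes> g (1 / ?b))"
    using q(2) g(2)[of ?b "1 / ?b", symmetric] by (simp add: g(3))
  also have "\<dots> = (f q \<otimes> f ?b) \<otimes> g (1 / ?b)"
    by (simp add: int f.S.m_assoc)
  also have "\<dots> = g (of_int a) \<otimes> g (1 / ?b)"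
    using q f(2)[of q ?b] by (simp add: int)
  also have "\<dots> = g q"
    using q g(2)[of "of_int a" "1 / ?b"] by simp
  finally show ?thesis .
qed

section \<open>Subfields and automorphisms of \<open>Qbar\<close>\<close>

lemma Qbar_simps:
  "carrier Qbar = UNIV" "x \<otimes>\<^bsub>Qbar\<^esub> y = x * y" "x \<oplus>\<^bsub>Qbar\<^esub> y = x + y" "\<one>\<^bsub>Qbar\<^esub> = 1" "\<zero>\<^bsub>Qbar\<^esub> = 0"
  by (simp_all add: ring_of_type_algebra_def)

lemma Qbar_field: "field Qbar"
  by (rule field_from_type_algebra)

lemma Qbar_uminus: "\<ominus>\<^bsub>Qbar\<^esub> x = - x"
  using abelian_group.minus_equality[of Qbar "- x" x] Qbar_field
  by (simp add: Qbar_simps field_def domain_def cring_def ring_def)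

lemma Qbar_inverse: "x \<noteq> 0 \<Longrightarrow> inv\<^bsub>Qbar\<^esub> x = inverse x"
  using monoid.inv_char[of Qbar x "inverse x"] Qbar_field
  by (simp add: Qbar_simps field_def domain_def cring_def ring_def)

lemma subfield_QbarD:
  assumes "subfield K Qbar"
  shows "0 \<in> K" "1 \<in> K" "\<And>x y. x \<in> K \<Longrightarrow> y \<in> K \<Longrightarrow> x + y \<in> K"
    "\<And>x y. x \<in> K \<Longrightarrow> y \<in> K \<Longrightarrow> x * y \<in> K" "\<And>x. x \<in> K \<Longrightarrow> - x \<in> K"
    "\<And>x y. x \<in> K \<Longrightarrow> y \<in> K \<Longrightarrow> x - y \<in> K" "\<And>x. x \<in> K \<Longrightarrow> inverse x \<in> K"
    "\<And>x y. x \<in> K \<Longrightarrow> y \<in> K \<Longrightarrow> x / y \<in> K"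
proof -
  note r = subringE[OF subfieldE(1)[OF assms], unfolded Qbar_simps Qbar_uminus]
  show "0 \<in> K" "1 \<in> K" and add: "\<And>x y. x \<in> K \<Longrightarrow> y \<in> K \<Longrightarrow> x + y \<in> K"
    and mult: "\<And>x y. x \<in> K \<Longrightarrow> y \<in> K \<Longrightarrow> x * y \<in> K" and uminus: "\<And>x. x \<in> K \<Longrightarrow> - x \<in> K"
    by (fact r)+
  show "x - y \<in> K" if "x \<in> K" "y \<in> K" for x y
    using add[OF that(1) uminus[OF that(2)]] by simp
  interpret field Qbar by (rule Qbar_field)
  show inverse: "inverse x \<in> K" if "x \<in> K" for x
    using subfield_m_inv(1)[OF assms, of x] that r(2)
    by (cases "x = 0") (auto simp: Qbar_simps Qbar_inverse)
  show "x / y \<in> K" if "x \<in> K" "y \<in> K" for x y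
    using mult[OF that(1) inverse[OF that(2)]] by (simp add: divide_inverse)
qed

lemma subfield_QbarI:
  assumes "1 \<in> K" "\<And>x y. x \<in> K \<Longrightarrow> y \<in> K \<Longrightarrow> x + y \<in> K" "\<And>x y. x \<in> K \<Longrightarrow> y \<in> K \<Longrightarrow> x * y \<in> K"
    "\<And>x. x \<in> K \<Longrightarrow> - x \<in> K" "\<And>x. x \<in> K \<Longrightarrow> inverse x \<in> K"
  shows "subfield K Qbar"
proof -
  interpret field Qbar by (rule Qbar_field)
  show ?thesis
    by (intro subfieldI' subringI) (use assms in \<open>auto simp: Qbar_simps Qbar_uminus Qbar_inverse\<close>)
qed

lemma subfield_Qbar_Inter:
  assumes "\<And>K. K \<in> \<S> \<Longrightarrow> subfield K Qbar"
  shows "subfield (\<Inter>\<S>) Qbar"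
proof (rule subfield_QbarI)
  show "1 \<in> \<Inter>\<S>" using subfield_QbarD(2)[OF assms] by simp
  show "x + y \<in> \<Inter>\<S>" if "x \<in> \<Inter>\<S>" "y \<in> \<Inter>\<S>" for x y
    using subfield_QbarD(3)[OF assms] that by simp
  show "x * y \<in> \<Inter>\<S>" if "x \<in> \<Inter>\<S>" "y \<in> \<Inter>\<S>" for x y
    using subfield_QbarD(4)[OF assms] that by simp
  show "- x \<in> \<Inter>\<S>" if "x \<in> \<Inter>\<S>" for x
    using subfield_QbarD(5)[OF assms] that by simp
  show "inverse x \<in> \<Inter>\<S>" if "x \<in> \<Inter>\<S>" for x
    using subfield_QbarD(7)[OF assms] that by simp
qed

lemma to_ac_in_subfield:
  assumes "subfield K Qbar"
  shows "to_ac q \<in> K"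
proof -
  note K = subfield_QbarD[OF assms]
  have nat: "of_nat n \<in> K" for n
    by (induction n) (auto intro: K)
  have int: "of_int k \<in> K" for k
    by (cases k) (auto intro: nat K simp del: of_nat_Suc)
  obtain a b where "q = of_int a / of_int b"
    by (metis quotient_of_div surj_pair)
  then show ?thesis by (simp add: int K)
qed

lemma to_ac_ring_hom: "to_ac \<in> ring_hom (ring_of_type_algebra :: rat ring) Qbar"
  by (simp add: ring_hom_def ring_of_type_algebra_def)

lemma Qbar_auto_hom:
  assumes "\<sigma> \<in> ring_iso Qbar Qbar"
  shows "\<sigma> (x + y) = \<sigma> x + \<sigma> y" "\<sigma> (x * y) = \<sigma> x * \<sigma> y" "\<sigma> 1 = 1" "bij \<sigma>"
  using assms by (simp_all add: ring_iso_def ring_hom_def Qbar_simps)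

lemma Qbar_auto_zero: "\<sigma> \<in> ring_iso Qbar Qbar \<Longrightarrow> \<sigma> 0 = 0"
  using Qbar_auto_hom(1)[of \<sigma> 0 0] by simp

lemma Qbar_auto_uminus: "\<sigma> \<in> ring_iso Qbar Qbar \<Longrightarrow> \<sigma> (- x) = - \<sigma> x"
  using Qbar_auto_hom(1)[of \<sigma> "- x" x] Qbar_auto_zero[of \<sigma>] by (simp add: eq_neg_iff_add_eq_0)

lemma Qbar_auto_diff: "\<sigma> \<in> ring_iso Qbar Qbar \<Longrightarrow> \<sigma> (x - y) = \<sigma> x - \<sigma> y"
  using Qbar_auto_hom(1)[of \<sigma> x "- y"] Qbar_auto_uminus[of \<sigma> y] by simp

lemma Qbar_auto_sum: "\<sigma> \<in> ring_iso Qbar Qbar \<Longrightarrow> \<sigma> (\<Sum>i\<in>I. f i) = (\<Sum>i\<in>I. \<sigma> (f i))"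
  by (induction I rule: infinite_finite_induct) (simp_all add: Qbar_auto_zero Qbar_auto_hom)

lemma Qbar_auto_to_ac:
  assumes "\<sigma> \<in> ring_iso Qbar Qbar"
  shows "\<sigma> (to_ac q) = to_ac q"
proof -
  have "\<sigma> \<circ> to_ac \<in> ring_hom (ring_of_type_algebra :: rat ring) Qbar"
    using assms by (intro ring_hom_trans[OF to_ac_ring_hom]) (simp add: ring_iso_def)
  from ring_hom_rat_unique[OF this to_ac_ring_hom ring_from_type_algebra, of q]
  show ?thesis by simp
qed

lemma id_Qbar_auto: "id \<in> ring_iso Qbar Qbar"
  by (simp add: ring_iso_def ring_hom_def Qbar_simps)

lemma Qbar_auto_comp:
  "\<sigma> \<in> ring_iso Qbar Qbar \<Longrightarrow> \<tau> \<in> ring_iso Qbar Qbar \<Longrightarrow> \<sigma> \<circ> \<tau> \<in> ring_iso Qbar Qbar"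
  by (rule ring_iso_set_trans)

lemma Qbar_auto_inv:
  assumes "\<sigma> \<in> ring_iso Qbar Qbar"
  shows "inv_into UNIV \<sigma> \<in> ring_iso Qbar Qbar"
  using ring_iso_set_sym[OF ring_from_type_algebra assms] by (simp add: Qbar_simps)

lemma partial_embedding_restrict:
  assumes "subfield K Qbar" "\<sigma> \<in> ring_iso Qbar Qbar"
  shows "partial_embedding {(x, \<sigma> x) | x. x \<in> K}"
  using subfield_QbarD[OF assms(1)] to_ac_in_subfield[OF assms(1)]
    Qbar_auto_hom[OF assms(2)] Qbar_auto_zero[OF assms(2)] Qbar_auto_to_ac[OF assms(2)]
  by (auto simp: partial_embedding_def)

lemma subfield_Qbar_UNIV: "subfield UNIV Qbar"
  using field.carrier_is_subfield[OF Qbar_field] by (simp add: Qbar_simps)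

lemma Qbar_auto_root:
  assumes "\<sigma> \<in> ring_iso Qbar Qbar" "poly (map_poly to_ac p) x = 0"
  shows "poly (map_poly to_ac p) (\<sigma> x) = 0"
  by (rule partial_embedding_root[OF partial_embedding_restrict[OF subfield_Qbar_UNIV assms(1)] _ assms(2)])
    auto

text \<open>
  In characteristic zero a polynomial of minimal degree over \<open>K\<close> with root \<open>x\<close> does not vanish to
  order two at \<open>x\<close>, because its derivative is also a polynomial over \<open>K\<close>.
\<close>

lemma fixed_field_Gal:
  assumes K: "subfield K Qbar" and x: "x \<notin> K"
  obtains \<rho> where "\<rho> \<in> Gal K" "\<rho> x \<noteq> x"
proof -
  note KD = subfield_QbarD[OF K]
  \<comment> \<open>For the graph of the identity of \<open>K\<close>, \<open>rel_poly\<close> is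
    equality of polynomials over \<open>K\<close>, and extensions of \<open>G\<close> fix
    \<open>K\<close>.\<close>
  define G where "G = {(a, id a) | a. a \<in> K}"
  have G: "partial_embedding G"
    unfolding G_def by (rule partial_embedding_restrict[OF K id_Qbar_auto])
  have rel: "rel_poly G p r \<longleftrightarrow> r = p \<and> (\<forall>i. Polynomial.coeff p i \<in> K)" for p r
    by (auto simp: rel_poly_def G_def poly_eq_iff)
  obtain f f' where "rel_poly G f f'" and f: "f \<noteq> 0" "poly f x = 0"
    and min: "\<And>p r. rel_poly G p r \<Longrightarrow> p \<noteq> 0 \<Longrightarrow> poly p x = 0 \<Longrightarrow>
      Polynomial.degree f \<le> Polynomial.degree p"
    using minimal_rel_poly[OF G] by blast
  then have f': "rel_poly G f f" and cf: "Polynomial.coeff f i \<in> K" for i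
    by (auto simp: rel)
  obtain g where g: "f = [:- x, 1:] * g"
    using f(2) by (auto simp: poly_eq_0_iff_dvd)
  have g0: "g \<noteq> 0" using g f(1) by auto
  have deg: "Polynomial.degree f = Suc (Polynomial.degree g)"
    using degree_mult_eq[OF _ g0, of "[:- x, 1:]"] by (simp add: g)
  \<comment> \<open>If \<open>g\<close> were constant, \<open>f\<close> would be linear over
    \<open>K\<close> and its root \<open>x\<close> would lie in \<open>K\<close>. So
    \<open>g\<close> has a root \<open>y\<close>, the intended image of \<open>x\<close>.\<close>
  have "Polynomial.degree g > 0"
  proof (rule ccontr)
    assume "\<not> Polynomial.degree g > 0"
    then obtain c where c: "g = [:c:]" by (auto elim: degree_eq_zeroE)
    then have "c \<in> K" "- (x * c) \<in> K" "c \<noteq> 0"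
      using cf[of 1] cf[of 0] g0 by (auto simp: g mult.commute)
    from KD(8)[OF KD(5)[OF this(2)] this(1)] this(3) show False using x by simp
  qed
  then obtain y where y: "poly g y = 0"
    using alg_closed_imp_poly_has_root by blast
  have "y \<noteq> x"
  proof
    assume "y = x"
    then have "poly (pderiv f) x = 0"
      using y unfolding g pderiv_mult by simp
    moreover have "pderiv f \<noteq> 0"
      using deg by (simp add: pderiv_eq_0_iff)
    moreover have "rel_poly G (pderiv f) (pderiv f)"
      using cf to_ac_in_subfield[OF K, of "of_nat n" for n]
      by (auto simp: rel coeff_pderiv simp del: of_nat_Suc intro!: KD(4))
    ultimately have "Polynomial.degree f \<le> Polynomial.degree (pderiv f)"
      using min by blast
    then show False using deg by (simp add: degree_pderiv)
  qed
  have "poly f y = 0" using y by (simp add: g)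
  then have "\<exists>H. partial_embedding H \<and> G \<subseteq> H \<and> (x, y) \<in> H"
    by (intro partial_embedding_extend_root[OF G f' f]) (use min in auto)
  then obtain H where H: "partial_embedding H" "G \<subseteq> H" "(x, y) \<in> H" by blast
  then obtain \<rho> where "\<rho> \<in> ring_iso Qbar Qbar" "\<And>a b. (a, b) \<in> H \<Longrightarrow> \<rho> a = b"
    using partial_embedding_extends_to_automorphism by blast
  with H \<open>y \<noteq> x\<close> have "\<rho> \<in> Gal K" "\<rho> x \<noteq> x"
    by (auto simp: Gal_def G_def)
  then show ?thesis using that by blast
qed

text \<open>Normality is phrased with irreducible polynomials, so each element needs one. In a
  factorization of an annihilator of least degree, one factor vanishes at \<open>x\<close> and so
  has full degree; the other is then constant.\<close>

lemma irreducible_rat_poly: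
  fixes x :: "rat alg_closure"
  obtains f :: "rat poly" where "Factorial_Ring.irreducible f" "poly (map_poly to_ac f) x = 0"
proof -
  let ?P = "\<lambda>p :: rat poly. p \<noteq> 0 \<and> poly (map_poly to_ac p) x = 0"
  obtain p where "?P p" using alg_closure_algebraic by blast
  from ex_has_least_nat[of ?P, OF this, of Polynomial.degree]
  obtain f where f: "?P f" and min: "\<And>p. ?P p \<Longrightarrow> Polynomial.degree f \<le> Polynomial.degree p"
    by blast
  have mult: "map_poly to_ac (a * b) = map_poly to_ac a * map_poly to_ac b" for a b :: "rat poly"
    by (simp add: poly_eq_iff coeff_map_poly coeff_mult to_ac_sum)
  have "Factorial_Ring.irreducible f"
  proof (rule irreducibleI)
    show "f \<noteq> 0" using f by simp
    show "\<not> f dvd 1"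
    proof
      assume "f dvd 1"
      then obtain c where "f = [:c:]" using f is_unit_iff_degree degree_eq_zeroE by metis
      with f show False by (simp add: map_poly_pCons)
    qed
    fix a b assume ab: "f = a * b"
    with f have "a \<noteq> 0" "b \<noteq> 0" by auto
    moreover from this have "Polynomial.degree f = Polynomial.degree a + Polynomial.degree b"
      by (simp add: ab degree_mult_eq)
    moreover have "?P a \<or> ?P b" using f by (auto simp: ab mult)
    ultimately show "a dvd 1 \<or> b dvd 1"
      using min[of a] min[of b] is_unit_iff_degree by fastforce
  qed
  with f show ?thesis using that by blast
qed

section \<open>Normal closures\<close>

lemma subfield_normal_closure: "subfield (normal_closure E) Qbar"
  unfolding normal_closure_def by (rule subfield_Qbar_Inter) (auto simp: normal_over_rat_def)

text \<open>An irreducible polynomial vanishing at \<open>x\<close> has all its roots, among them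
  \<open>\<sigma> x\<close>, in each normal field that contains \<open>x\<close>. Stability under
  automorphisms is the form in which normality enters the disjointness argument.\<close>

lemma normal_closure_auto:
  assumes "\<sigma> \<in> ring_iso Qbar Qbar" "x \<in> normal_closure E"
  shows "\<sigma> x \<in> normal_closure E"
proof -
  obtain f where f: "Factorial_Ring.irreducible f" "poly (map_poly to_ac f) x = 0"
    by (rule irreducible_rat_poly)
  have "\<sigma> x \<in> M" if "normal_over_rat M" "x \<in> M" for M
  proof -
    have "{z. poly (map_poly to_ac f) z = 0} \<subseteq> M"
      using that f unfolding normal_over_rat_def by metis
    with Qbar_auto_root[OF assms(1) f(2)] show ?thesis by auto
  qed
  with assms(2) show ?thesis by (auto simp: normal_closure_def)
qed

lemma subset_normal_closure: "E \<subseteq> normal_closure E"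
  by (auto simp: normal_closure_def)

section \<open>The compositum of a normal field with another field\<close>

inductive_set compositum_graph ::
  "(rat alg_closure \<Rightarrow> rat alg_closure) \<Rightarrow> rat alg_closure set \<Rightarrow> rat alg_closure set \<Rightarrow>
   (rat alg_closure \<times> rat alg_closure) set" for \<sigma> M N where
  mult: "m \<in> M \<Longrightarrow> n \<in> N \<Longrightarrow> (m * n, \<sigma> m * n) \<in> compositum_graph \<sigma> M N"
| add: "(a, b) \<in> compositum_graph \<sigma> M N \<Longrightarrow> (c, d) \<in> compositum_graph \<sigma> M N \<Longrightarrow>
    (a + c, b + d) \<in> compositum_graph \<sigma> M N"

text \<open>Brings a pair into the indexed form of a linear relation, so that
  \<open>relation_transfer\<close> applies. Sums are handled by concatenating the index
  ranges.\<close>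

lemma compositum_graph_sum:
  assumes "(a, b) \<in> compositum_graph \<sigma> M N"
  shows "\<exists>(k :: nat) m n. (\<forall>i < k. m i \<in> M \<and> n i \<in> N) \<and>
    a = (\<Sum>i<k. m i * n i) \<and> b = (\<Sum>i<k. \<sigma> (m i) * n i)"
  using assms
proof induction
  case (mult m n)
  then show ?case by (intro exI[of _ "Suc 0"] exI[of _ "\<lambda>_. m"] exI[of _ "\<lambda>_. n"]) simp
next
  case (add a b c d)
  then obtain k k' :: nat and m n m' n' where kmn:
    "\<forall>i < k. m i \<in> M \<and> n i \<in> N" "a = (\<Sum>i<k. m i * n i)" "b = (\<Sum>i<k. \<sigma> (m i) * n i)"
    "\<forall>i < k'. m' i \<in> M \<and> n' i \<in> N" "c = (\<Sum>i<k'. m' i * n' i)" "d = (\<Sum>i<k'. \<sigma> (m' i) * n' i)"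
    by (elim exE conjE) blast
  have "(\<Sum>i<k + k'. if i < k then f i else g (i - k)) = (\<Sum>i<k. f i) + (\<Sum>i<k'. g i)"
    for f g :: "nat \<Rightarrow> rat alg_closure"
    by (induction k') auto
  note split = this[symmetric]
  show ?case
    by (rule exI[of _ "k + k'"], rule exI[of _ "\<lambda>i. if i < k then m i else m' (i - k)"],
        rule exI[of _ "\<lambda>i. if i < k then n i else n' (i - k)"])
      (use kmn in \<open>auto simp: split intro!: sum.cong\<close>)
qed

text \<open>
  Artin's minimal relation argument: a relation with coefficients in \<open>M\<close> that are not all in
  \<open>M \<inter> N\<close> is a combination of two shorter ones, obtained by subtracting its image under an
  automorphism over \<open>N\<close> which moves a coefficient.
\<close>

lemma relation_transfer:
  assumes M: "subfield M Qbar" and N: "subfield N Qbar"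
    and normal: "\<And>\<rho> x. \<rho> \<in> ring_iso Qbar Qbar \<Longrightarrow> x \<in> M \<Longrightarrow> \<rho> x \<in> M"
    and \<sigma>: "\<sigma> \<in> Gal (N \<inter> M)"
    and I: "finite I" and n: "\<And>i. i \<in> I \<Longrightarrow> n i \<in> N"
    and m: "\<And>i. i \<in> I \<Longrightarrow> m i \<in> M" and rel: "(\<Sum>i\<in>I. m i * n i) = 0"
  shows "(\<Sum>i\<in>I. \<sigma> (m i) * n i) = 0"
  using I n m rel
proof (induction I arbitrary: m rule: finite_psubset_induct)
  case (psubset I)
  note MD = subfield_QbarD[OF M]
  have \<sigma>': "\<sigma> \<in> ring_iso Qbar Qbar" using \<sigma> by (simp add: Gal_def)
  note \<sigma>_hom = Qbar_auto_hom[OF \<sigma>'] Qbar_auto_zero[OF \<sigma>'] Qbar_auto_diff[OF \<sigma>']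
  \<comment> \<open>A relation with a zero coefficient lives on a proper subset of \<open>I\<close>,
    where the induction hypothesis applies.\<close>
  have shorter: "(\<Sum>i\<in>I. \<sigma> (c i) * n i) = 0"
    if c: "\<And>i. i \<in> I \<Longrightarrow> c i \<in> M" "(\<Sum>i\<in>I. c i * n i) = 0" and j: "j \<in> I" "c j = 0" for c j
  proof -
    have *: "sum f I = sum f (I - {j})" if "f j = 0" for f :: "_ \<Rightarrow> rat alg_closure"
      using that sum.remove[OF psubset.hyps(1) j(1), of f] by simp
    have "(\<Sum>i\<in>I - {j}. \<sigma> (c i) * n i) = 0"
      using j c psubset.prems(1) *[of "\<lambda>i. c i * n i"]
      by (intro psubset.IH) auto
    then show ?thesis using *[of "\<lambda>i. \<sigma> (c i) * n i"] j(2) by (simp add: \<sigma>_hom)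
  qed
  show ?case
  proof (cases "\<exists>i\<in>I. m i = 0")
    case True
    then show ?thesis using shorter psubset.prems by blast
  next
    case nonzero: False
    show ?thesis
    proof (cases "I = {}")
      case False
      then obtain i0 where i0: "i0 \<in> I" by blast
      \<comment> \<open>Normalizing the coefficient at \<open>i0\<close> to 1 makes every
        automorphism fix it, so the difference \<open>c\<close> below vanishes there.\<close>
      define m' where "m' i = m i / m i0" for i
      have m'M: "m' i \<in> M" if "i \<in> I" for i
        unfolding m'_def using psubset.prems(2) that i0 by (intro MD) auto
      have rel': "(\<Sum>i\<in>I. m' i * n i) = 0"
        using psubset.prems(3) by (simp add: m'_def flip: sum_divide_distrib)
      have "(\<Sum>i\<in>I. \<sigma> (m' i) * n i) = 0"
      proof (cases "\<forall>i\<in>I. m' i \<in> N")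
        case True
        then have "\<sigma> (m' i) = m' i" if "i \<in> I" for i
          using \<sigma> m'M that by (auto simp: Gal_def)
        then show ?thesis using rel' by simp
      next
        case False
        then obtain j where j: "j \<in> I" "m' j \<notin> N" by blast
        obtain \<rho> where \<rho>: "\<rho> \<in> Gal N" "\<rho> (m' j) \<noteq> m' j"
          using fixed_field_Gal[OF N j(2)] by blast
        then have \<rho>': "\<rho> \<in> ring_iso Qbar Qbar" by (simp add: Gal_def)
        define c where "c i = \<rho> (m' i) - m' i" for i
        have cM: "c i \<in> M" if "i \<in> I" for i
          unfolding c_def using m'M[OF that] normal[OF \<rho>'] by (intro MD) auto
        have "(\<Sum>i\<in>I. \<rho> (m' i) * n i) = \<rho> (\<Sum>i\<in>I. m' i * n i)"
          using \<rho>(1) psubset.prems(1)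
          by (simp add: Qbar_auto_sum[OF \<rho>'] Qbar_auto_hom[OF \<rho>'] Gal_def)
        then have relc: "(\<Sum>i\<in>I. c i * n i) = 0"
          using rel' by (simp add: c_def left_diff_distrib sum_subtractf Qbar_auto_zero[OF \<rho>'])
        have cj: "c j \<noteq> 0" using \<rho>(2) by (simp add: c_def)
        have "c i0 = 0"
          using i0 nonzero by (simp add: c_def m'_def Qbar_auto_hom[OF \<rho>'])
        note relc_\<sigma> = shorter[of c, OF cM relc i0 this]
        \<comment> \<open>The factor is chosen to give \<open>d j = 0\<close>. Thus
          \<open>m'\<close> is \<open>d\<close> plus a multiple of \<open>c\<close>, where
          \<open>c\<close> vanishes at \<open>i0\<close> and \<open>d\<close> at \<open>j\<close>;
          both relations are shorter, and \<sigma> respects the combination.\<close>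
        define d where "d i = m' i - m' j / c j * c i" for i
        have dM: "d i \<in> M" if "i \<in> I" for i
          unfolding d_def using m'M cM that j by (intro MD) auto
        have "(\<Sum>i\<in>I. d i * n i) = (\<Sum>i\<in>I. m' i * n i) - m' j / c j * (\<Sum>i\<in>I. c i * n i)"
          by (simp add: d_def left_diff_distrib sum_subtractf sum_distrib_left mult.assoc)
        then have "(\<Sum>i\<in>I. d i * n i) = 0" using rel' relc by simp
        moreover have "d j = 0" using cj by (simp add: d_def)
        ultimately have "(\<Sum>i\<in>I. \<sigma> (d i) * n i) = 0"
          using shorter[of d, OF dM] j(1) by blast
        moreover have "\<sigma> (d i) = \<sigma> (m' i) - \<sigma> (m' j / c j) * \<sigma> (c i)" for i
          unfolding d_def \<sigma>_hom(2,6) by (rule refl)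
        then have "(\<Sum>i\<in>I. \<sigma> (d i) * n i) =
            (\<Sum>i\<in>I. \<sigma> (m' i) * n i) - \<sigma> (m' j / c j) * (\<Sum>i\<in>I. \<sigma> (c i) * n i)"
          by (simp add: left_diff_distrib sum_subtractf sum_distrib_left mult.assoc)
        ultimately show ?thesis using relc_\<sigma> by simp
      qed
      then have "\<sigma> (m i0) * (\<Sum>i\<in>I. \<sigma> (m' i) * n i) = 0" by simp
      then have "(\<Sum>i\<in>I. \<sigma> (m i0 * m' i) * n i) = 0"
        by (simp add: \<sigma>_hom sum_distrib_left mult.assoc)
      moreover have "m i0 * m' i = m i" for i
        using i0 nonzero by (simp add: m'_def)
      ultimately show ?thesis by simp
    qed simp
  qed
qed

text \<open>Single-valuedness at 0 is \<open>relation_transfer\<close>, applied to an expression of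
  0 as a sum of products; closure under multiplication uses that \<sigma> is multiplicative.\<close>

lemma partial_embedding_compositum:
  assumes M: "subfield M Qbar" and N: "subfield N Qbar"
    and normal: "\<And>\<rho> x. \<rho> \<in> ring_iso Qbar Qbar \<Longrightarrow> x \<in> M \<Longrightarrow> \<rho> x \<in> M"
    and \<sigma>: "\<sigma> \<in> Gal (N \<inter> M)"
  shows "partial_embedding (compositum_graph \<sigma> M N)"
proof -
  have \<sigma>': "\<sigma> \<in> ring_iso Qbar Qbar" using \<sigma> by (simp add: Gal_def)
  note MD = subfield_QbarD[OF M] and ND = subfield_QbarD[OF N]
  \<comment> \<open>A product of two sums of products is expanded by one induction per factor; here
    the second factor is a single product.\<close>
  have mult_tensor: "(a * (m * n), b * (\<sigma> m * n)) \<in> compositum_graph \<sigma> M N"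
    if "(a, b) \<in> compositum_graph \<sigma> M N" "m \<in> M" "n \<in> N" for a b m n
    using that(1)
  proof induction
    case (mult m' n')
    then show ?case
      using compositum_graph.mult[of "m' * m" M "n' * n" N \<sigma>] that MD(4) ND(4)
      by (simp add: Qbar_auto_hom[OF \<sigma>'] mult_ac)
  next
    case (add a b c d)
    then show ?case
      using compositum_graph.add by (fastforce simp: distrib_right)
  qed
  have mult: "(a * c, b * d) \<in> compositum_graph \<sigma> M N"
    if "(a, b) \<in> compositum_graph \<sigma> M N" "(c, d) \<in> compositum_graph \<sigma> M N" for a b c d
    using that(2)
  proof induction
    case (mult m n)
    then show ?case using mult_tensor that(1) by blast
  next
    case (add c d e f)
    then show ?case using compositum_graph.add by (fastforce simp: distrib_left)
  qed
  have const: "(to_ac q, to_ac q) \<in> compositum_graph \<sigma> M N" for q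
    using compositum_graph.mult[OF to_ac_in_subfield[OF M, of q] ND(2), of \<sigma>]
    by (simp add: Qbar_auto_to_ac[OF \<sigma>'])
  have zero: "b = 0" if b: "(0, b) \<in> compositum_graph \<sigma> M N" for b
  proof -
    obtain k :: nat and m n where mn: "\<forall>i < k. m i \<in> M \<and> n i \<in> N"
      "0 = (\<Sum>i<k. m i * n i)" "b = (\<Sum>i<k. \<sigma> (m i) * n i)"
      using compositum_graph_sum[OF b] by blast
    show ?thesis
      unfolding mn(3) by (rule relation_transfer[OF M N _ \<sigma>]) (use mn(1,2) normal in auto)
  qed
  show ?thesis
    unfolding partial_embedding_def using const mult zero compositum_graph.add by blast
qed

text \<open>The map on the compositum extends to an automorphism \<tau>. Products with second factor
  1 show that \<tau> is \<sigma> on the normal closure, those with first factor 1 that it fixes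
  \<open>N\<close>. What remains of \<sigma>, namely \<tau> inverse after \<sigma>, is trivial on
  the normal closure.\<close>

lemma Gal_inter_normal_closure:
  assumes N: "subfield N Qbar" and \<sigma>: "\<sigma> \<in> Gal (N \<inter> normal_closure E)"
  obtains \<tau> \<rho> where "\<tau> \<in> Gal N" "\<rho> \<in> Gal (normal_closure E)" "\<sigma> = \<tau> \<circ> \<rho>"
proof -
  let ?M = "normal_closure E"
  note M = subfield_normal_closure[of E]
  have \<sigma>': "\<sigma> \<in> ring_iso Qbar Qbar" using \<sigma> by (simp add: Gal_def)
  have "partial_embedding (compositum_graph \<sigma> ?M N)"
    by (rule partial_embedding_compositum[OF M N _ \<sigma>]) (rule normal_closure_auto)
  then obtain \<tau> where \<tau>: "\<tau> \<in> ring_iso Qbar Qbar"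
    and eq: "\<And>a b. (a, b) \<in> compositum_graph \<sigma> ?M N \<Longrightarrow> \<tau> a = b"
    using partial_embedding_extends_to_automorphism by blast
  have "\<tau> n = n" if "n \<in> N" for n
    using eq[OF compositum_graph.mult[OF subfield_QbarD(2)[OF M] that]]
    by (simp add: Qbar_auto_hom[OF \<sigma>'])
  then have "\<tau> \<in> Gal N" using \<tau> by (simp add: Gal_def)
  moreover have \<tau>\<sigma>: "\<tau> m = \<sigma> m" if "m \<in> ?M" for m
    using eq[OF compositum_graph.mult[OF that subfield_QbarD(2)[OF N]]] by simp
  have "bij \<tau>" by (rule Qbar_auto_hom(4)[OF \<tau>])
  define \<rho> where "\<rho> = inv_into UNIV \<tau> \<circ> \<sigma>"
  have "\<rho> \<in> ring_iso Qbar Qbar"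
    unfolding \<rho>_def by (intro Qbar_auto_comp Qbar_auto_inv \<tau> \<sigma>')
  moreover have "\<rho> m = m" if "m \<in> ?M" for m
    using inv_f_f[OF bij_is_inj[OF \<open>bij \<tau>\<close>], of m] by (simp add: \<rho>_def \<tau>\<sigma>[OF that])
  ultimately have "\<rho> \<in> Gal ?M" by (simp add: Gal_def)
  moreover have "\<sigma> = \<tau> \<circ> \<rho>"
    using \<open>bij \<tau>\<close> by (auto simp: \<rho>_def bij_is_surj surj_f_inv_f)
  ultimately show ?thesis using that \<open>\<tau> \<in> Gal N\<close> by blast
qed



section \<open>Morphisms of schemes\<close>

lemma morphism_pt: "morphism \<XX> Y f \<Longrightarrow> x \<in> space \<XX> \<Longrightarrow> pt f x \<in> space Y"
  by (auto simp: morphism_def continuous_map_def)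

lemma morphism_sh: "morphism \<XX> Y f \<Longrightarrow> openin (Top Y) V \<Longrightarrow> sh f V \<in> ring_hom (Sec Y V) (Sec \<XX> (preim \<XX> f V))"
  by (simp add: morphism_def)

lemma morphism_sh_closed:
  "morphism \<XX> Y f \<Longrightarrow> openin (Top Y) V \<Longrightarrow> s \<in> carrier (Sec Y V) \<Longrightarrow>
    sh f V s \<in> carrier (Sec \<XX> (preim \<XX> f V))"
  by (rule ring_hom_closed[OF morphism_sh])

lemma morphism_Res:
  "morphism \<XX> Y f \<Longrightarrow> openin (Top Y) V \<Longrightarrow> openin (Top Y) W \<Longrightarrow> W \<subseteq> V \<Longrightarrow> s \<in> carrier (Sec Y V) \<Longrightarrow>
    sh f W (Res Y V W s) = Res \<XX> (preim \<XX> f V) (preim \<XX> f W) (sh f V s)"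
  by (simp add: morphism_def)

lemma morphism_local:
  "morphism \<XX> Y f \<Longrightarrow> openin (Top Y) V \<Longrightarrow> s \<in> carrier (Sec Y V) \<Longrightarrow> x \<in> preim \<XX> f V \<Longrightarrow>
    invertible_at \<XX> (preim \<XX> f V) (sh f V s) x \<Longrightarrow> invertible_at Y V s (pt f x)"
  by (simp add: morphism_def)

lemma openin_preim: "morphism \<XX> Y f \<Longrightarrow> openin (Top Y) V \<Longrightarrow> openin (Top \<XX>) (preim \<XX> f V)"
  by (auto simp: morphism_def continuous_map_def preim_def)

lemma preim_space: "morphism \<XX> Y f \<Longrightarrow> preim \<XX> f (space Y) = space \<XX>"
  by (auto simp: preim_def morphism_pt)

lemma preim_empty [simp]: "preim \<XX> f {} = {}"
  by (simp add: preim_def)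

lemma preim_mono: "V \<subseteq> W \<Longrightarrow> preim \<XX> f V \<subseteq> preim \<XX> f W"
  by (auto simp: preim_def)

lemma preim_comp: "morphism \<XX> Y f \<Longrightarrow> preim \<XX> (comp_mor Y g f) V = preim \<XX> f (preim Y g V)"
  by (auto simp: preim_def comp_mor_def morphism_pt)

lemma morphism_comp:
  assumes f: "morphism \<XX> Y f" and g: "morphism Y Z g"
  shows "morphism \<XX> Z (comp_mor Y g f)"
  unfolding morphism_def preim_comp[OF f]
proof (intro conjI allI impI ballI)
  show "continuous_map (Top \<XX>) (Top Z) (pt (comp_mor Y g f))"
    using f g by (auto simp: comp_mor_def morphism_def intro: continuous_map_compose)
next
  fix V assume "openin (Top Z) V"
  then show "sh (comp_mor Y g f) V \<in> ring_hom (Sec Z V) (Sec \<XX> (preim \<XX> f (preim Y g V)))"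
    using ring_hom_trans[OF morphism_sh[OF g] morphism_sh[OF f openin_preim[OF g]]]
    by (simp add: comp_mor_def)
next
  fix V W s
  assume "openin (Top Z) V \<and> openin (Top Z) W \<and> W \<subseteq> V" "s \<in> carrier (Sec Z V)"
  then show "sh (comp_mor Y g f) W (Res Z V W s) =
      Res \<XX> (preim \<XX> f (preim Y g V)) (preim \<XX> f (preim Y g W)) (sh (comp_mor Y g f) V s)"
    by (simp add: comp_mor_def morphism_Res[OF g]
        morphism_Res[OF f openin_preim[OF g] openin_preim[OF g] preim_mono morphism_sh_closed[OF g]])
next
  fix V s x
  assume *: "openin (Top Z) V" "s \<in> carrier (Sec Z V)" "x \<in> preim \<XX> f (preim Y g V)"
    "invertible_at \<XX> (preim \<XX> f (preim Y g V)) (sh (comp_mor Y g f) V s) x"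
  then have "invertible_at Y (preim Y g V) (sh g V s) (pt f x)"
    by (intro morphism_local[OF f openin_preim[OF g] morphism_sh_closed[OF g]])
      (simp_all add: comp_mor_def)
  moreover have "pt f x \<in> preim Y g V" using *(3) by (simp add: preim_def)
  ultimately show "invertible_at Z V s (pt (comp_mor Y g f) x)"
    using morphism_local[OF g *(1,2)] by (simp add: comp_mor_def)
qed

lemma morphism_id: "morphism \<XX> \<XX> id_mor"
proof -
  have *: "preim \<XX> id_mor V = V" if "openin (Top \<XX>) V" for V
    using openin_subset[OF that] by (auto simp: preim_def id_mor_def)
  show ?thesis
    unfolding morphism_def using * by (auto simp: id_mor_def ring_hom_def continuous_map_id[unfolded id_def])
qed

text \<open>An equality of records and not only up to \<open>eq_mor\<close>, so it can be used for
  rewriting. That \<open>g\<close> maps into \<open>Z\<close> is what lets preimages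
  compose.\<close>

lemma comp_mor_assoc:
  assumes "morphism Y Z g"
  shows "comp_mor Y (comp_mor Z k g) f = comp_mor Z k (comp_mor Y g f)"
proof -
  have "sh (comp_mor Y (comp_mor Z k g) f) = sh (comp_mor Z k (comp_mor Y g f))"
    by (rule ext, rule ext) (simp add: preim_comp[OF assms, unfolded comp_mor_def] comp_mor_def)
  then show ?thesis by (simp add: comp_mor_def o_assoc)
qed

section \<open>Equality of morphisms and uniqueness in fibre products\<close>

lemma eq_mor_refl [simp]: "eq_mor \<XX> Y f f"
  by (simp add: eq_mor_def)

lemma eq_mor_sym: "eq_mor \<XX> Y f g \<Longrightarrow> eq_mor \<XX> Y g f"
  by (simp add: eq_mor_def)

lemma eq_mor_trans [trans]: "eq_mor \<XX> Y f g \<Longrightarrow> eq_mor \<XX> Y g h \<Longrightarrow> eq_mor \<XX> Y f h"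
  by (simp add: eq_mor_def)

lemma eq_mor_comp_left:
  assumes "morphism Y Z g" "eq_mor \<XX> Y f f'"
  shows "eq_mor \<XX> Z (comp_mor Y g f) (comp_mor Y g f')"
  using assms openin_preim[OF assms(1)] morphism_sh_closed[OF assms(1)]
  by (simp add: eq_mor_def comp_mor_def)

lemma eq_mor_comp_right:
  assumes "morphism \<XX> Y f" "eq_mor Y Z g g'"
  shows "eq_mor \<XX> Z (comp_mor Y g f) (comp_mor Y g' f)"
proof -
  have "preim Y g V = preim Y g' V" for V
    using assms(2) by (auto simp: eq_mor_def preim_def)
  then show ?thesis
    using assms(2) morphism_pt[OF assms(1)] by (simp add: eq_mor_def comp_mor_def)
qed

lemma comp_mor_id:
  assumes "morphism \<XX> Y f"
  shows "eq_mor \<XX> Y (comp_mor \<XX> f id_mor) f" "eq_mor \<XX> Y (comp_mor Y id_mor f) f"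
proof -
  have "preim Y id_mor V = V" if "openin (Top Y) V" for V
    using openin_subset[OF that] by (auto simp: preim_def id_mor_def)
  then show "eq_mor \<XX> Y (comp_mor \<XX> f id_mor) f" "eq_mor \<XX> Y (comp_mor Y id_mor f) f"
    by (auto simp: eq_mor_def comp_mor_def id_mor_def)
qed

text \<open>Both \<open>h\<close> and \<open>h'\<close> solve the lifting problem posed by the
  projections of \<open>h'\<close>, so both equal the solution given by the universal
  property.\<close>

lemma fibre_product_unique:
  assumes fp: "fibre_product \<XX> Y S f g W p q" and f: "morphism \<XX> S f" and g: "morphism Y S g"
    and T: "scheme T" and h: "morphism T W h" and h': "morphism T W h'"
    and p: "eq_mor T \<XX> (comp_mor W p h) (comp_mor W p h')"
    and q: "eq_mor T Y (comp_mor W q h) (comp_mor W q h')"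
  shows "eq_mor T W h h'"
proof -
  have mor: "morphism W \<XX> p" "morphism W Y q"
    and comm: "eq_mor W S (comp_mor \<XX> f p) (comp_mor Y g q)"
    using fp by (simp_all add: fibre_product_def)
  have "eq_mor T S (comp_mor \<XX> f (comp_mor W p h')) (comp_mor Y g (comp_mor W q h'))"
    using eq_mor_comp_right[OF h' comm]
    by (simp add: comp_mor_assoc[OF mor(1)] comp_mor_assoc[OF mor(2)])
  moreover have "morphism T \<XX> (comp_mor W p h')" "morphism T Y (comp_mor W q h')"
    using morphism_comp h' mor by blast+
  ultimately obtain k where
    "\<And>j. morphism T W j \<Longrightarrow> eq_mor T \<XX> (comp_mor W p j) (comp_mor W p h') \<Longrightarrow>
      eq_mor T Y (comp_mor W q j) (comp_mor W q h') \<Longrightarrow> eq_mor T W j k"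
    using fp T unfolding fibre_product_def by metis
  from this[OF h p q] this[OF h' eq_mor_refl eq_mor_refl] show ?thesis
    using eq_mor_sym eq_mor_trans by blast
qed


section \<open>Spectra of fields\<close>

lemma scheme_sheaf: "scheme \<XX> \<Longrightarrow> sheaf_of_rings \<XX>"
  by (simp add: scheme_def)

text \<open>The gluing axiom for the empty cover.\<close>

lemma sections_over_empty:
  assumes "sheaf_of_rings \<XX>" "s \<in> carrier (Sec \<XX> {})" "t \<in> carrier (Sec \<XX> {})"
  shows "s = t"
proof -
  have "\<forall>\<U> s. (\<forall>U \<in> \<U>. openin (Top \<XX>) U \<and> s U \<in> carrier (Sec \<XX> U)) \<and>
        (\<forall>U \<in> \<U>. \<forall>V \<in> \<U>. Res \<XX> U (U \<inter> V) (s U) = Res \<XX> V (U \<inter> V) (s V)) \<longrightarrow>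
        (\<exists>!t. t \<in> carrier (Sec \<XX> (\<Union>\<U>)) \<and> (\<forall>U \<in> \<U>. Res \<XX> (\<Union>\<U>) U t = s U))"
    using assms(1) unfolding sheaf_of_rings_def by (elim conjE)
  from this[rule_format, of "{}"] have "\<exists>!t. t \<in> carrier (Sec \<XX> {})" by simp
  with assms(2,3) show ?thesis by blast
qed

lemma field_spectrumD:
  assumes "field_spectrum S"
  shows "scheme S" "sheaf_of_rings S" "field (global S)"
    "x \<in> space S \<Longrightarrow> y \<in> space S \<Longrightarrow> x = y"
    "openin (Top S) V \<Longrightarrow> V = {} \<or> V = space S" "space S \<noteq> {}"
  using assms openin_subset[of "Top S" V] by (auto simp: field_spectrum_def scheme_sheaf)

text \<open>With one point and two open sets in \<open>S\<close>, only global sections carry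
  information: over \<open>{}\<close> both morphisms land in a ring with a single element.\<close>

lemma eq_mor_field_spectrum:
  assumes S: "field_spectrum S" and T: "sheaf_of_rings T"
    and f: "morphism T S f" and g: "morphism T S g"
    and eq: "\<And>c. c \<in> carrier (global S) \<Longrightarrow> sh f (space S) c = sh g (space S) c"
  shows "eq_mor T S f g"
  unfolding eq_mor_def
proof (intro conjI allI impI ballI)
  show "pt f x = pt g x" if "x \<in> space T" for x
    using field_spectrumD(4)[OF S] morphism_pt f g that by metis
next
  fix V s assume V: "openin (Top S) V" and s: "s \<in> carrier (Sec S V)"
  show "sh f V s = sh g V s"
  proof (cases "V = {}")
    case True
    then show ?thesis
      using sections_over_empty[OF T] morphism_sh_closed[OF f V s] morphism_sh_closed[OF g V s] by simp
  next
    case False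
    then show ?thesis using field_spectrumD(5)[OF S V] eq s by auto
  qed
qed

text \<open>Reduces to the uniqueness of ring homomorphisms from the rationals. Compatibility of
  Galois automorphisms with the base then needs no computation.\<close>

lemma eq_mor_Spec_rat:
  assumes B: "Spec_rat B" and T: "sheaf_of_rings T" and f: "morphism T B f" and g: "morphism T B g"
  shows "eq_mor T B f g"
proof -
  obtain \<iota> where S: "field_spectrum B" and \<iota>: "\<iota> \<in> ring_iso (ring_of_type_algebra :: rat ring) (global B)"
    using B by (auto simp: Spec_rat_def spectrum_of_def)
  have hom: "sh k (space B) \<circ> \<iota> \<in> ring_hom (ring_of_type_algebra :: rat ring) (global T)"
    if "morphism T B k" for k
  proof (rule ring_hom_trans)
    show "\<iota> \<in> ring_hom ring_of_type_algebra (global B)" using \<iota> by (simp add: ring_iso_def)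
    show "sh k (space B) \<in> ring_hom (global B) (global T)"
      using morphism_sh[OF that openin_topspace] by (simp add: preim_space[OF that])
  qed
  have "ring (global T)"
    using T by (auto simp: sheaf_of_rings_def cring_def)
  from ring_hom_rat_unique[OF hom[OF f] hom[OF g] this]
  have "sh f (space B) (\<iota> q) = sh g (space B) (\<iota> q)" for q by simp
  moreover have "\<exists>q. c = \<iota> q" if "c \<in> carrier (global B)" for c
    using \<iota> that by (auto simp: ring_iso_def bij_betw_def)
  ultimately show ?thesis
    by (intro eq_mor_field_spectrum[OF S T f g]) blast
qed

lemma field_spectrum_endomorphism:
  assumes S: "field_spectrum S" and \<theta>: "\<theta> \<in> ring_iso (global S) (global S)"
  obtains g where "morphism S S g" "\<And>c. c \<in> carrier (global S) \<Longrightarrow> sh g (space S) c = \<theta> c"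
proof -
  note SD = field_spectrumD[OF S]
  have \<theta>_hom: "\<theta> \<in> ring_hom (global S) (global S)" using \<theta> by (simp add: ring_iso_def)
  \<comment> \<open>The only other open set is \<open>{}\<close>; its ring of sections has one
    element, so the identity there is compatible with restriction.\<close>
  define g where "g = \<lparr>pt = (\<lambda>x. x), sh = (\<lambda>V s. if V = space S then \<theta> s else s)\<rparr>"
  have pt_g: "pt g x = x" for x by (simp add: g_def)
  have pre: "preim S g V = V" if "openin (Top S) V" for V
    using openin_subset[OF that] by (auto simp: preim_def g_def)
  have Res_id: "Res S U U s = s" if "openin (Top S) U" "s \<in> carrier (Sec S U)" for U s
    using SD(2) that by (simp add: sheaf_of_rings_def)
  have Res_closed: "Res S U V s \<in> carrier (Sec S V)"
    if "openin (Top S) U" "openin (Top S) V" "V \<subseteq> U" "s \<in> carrier (Sec S U)" for U V s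
    using SD(2) that unfolding sheaf_of_rings_def by (meson ring_hom_closed)
  have sh_global: "sh g (space S) c = \<theta> c" for c by (simp add: g_def)
  have sh_hom: "sh g V \<in> ring_hom (Sec S V) (Sec S V)" for V
    using \<theta>_hom by (auto simp: g_def ring_hom_def)
  have "morphism S S g"
    unfolding morphism_def
  proof (intro conjI allI impI ballI)
    show "continuous_map (Top S) (Top S) (pt g)" by (simp add: g_def)
    show "sh g V \<in> ring_hom (Sec S V) (Sec S (preim S g V))" if "openin (Top S) V" for V
      using sh_hom by (simp add: pre that)
  next
    fix V W s assume VW: "openin (Top S) V \<and> openin (Top S) W \<and> W \<subseteq> V" and s: "s \<in> carrier (Sec S V)"
    then have closed: "sh g V s \<in> carrier (Sec S V)" using ring_hom_closed[OF sh_hom] by blast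
    show "sh g W (Res S V W s) = Res S (preim S g V) (preim S g W) (sh g V s)"
    proof (cases "W = {}")
      case True
      then show ?thesis
        using VW s closed Res_closed ring_hom_closed[OF sh_hom]
        by (intro sections_over_empty[OF SD(2)]) (simp_all add: pre)
    next
      case False
      then have "W = V" using VW SD(5) by blast
      then show ?thesis using VW s closed by (simp add: pre Res_id)
    qed
  next
    fix V s x
    assume V: "openin (Top S) V" and s: "s \<in> carrier (Sec S V)" and x: "x \<in> preim S g V"
      and inv: "invertible_at S (preim S g V) (sh g V s) x"
    from V x have V_eq: "V = space S" using SD(5)[OF V] by (auto simp: pre)
    obtain W where W: "openin (Top S) W" "x \<in> W" "Res S (space S) W (\<theta> s) \<in> Units (Sec S W)"
      using inv sh_global by (auto simp: invertible_at_def pre V_eq)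
    then have "W = space S" using SD(5)[OF W(1)] by auto
    with W s have unit: "\<theta> s \<in> Units (global S)"
      using ring_hom_closed[OF \<theta>_hom] by (simp add: Res_id V_eq)
    interpret field "global S" by (rule SD(3))
    \<comment> \<open>Locality is automatic over a field: a section with invertible image is
      nonzero, hence a unit.\<close>
    have "s \<noteq> \<zero>\<^bsub>global S\<^esub>"
      using unit ring_hom_zero[OF \<theta>_hom ring_axioms ring_axioms] by (auto simp: field_Units)
    then have "s \<in> Units (global S)" using s by (simp add: field_Units V_eq)
    then show "invertible_at S V s (pt g x)"
      using s x by (auto simp: invertible_at_def V_eq pre Res_id pt_g intro!: exI[of _ "space S"])
  qed
  then show ?thesis using that sh_global by blast
qed


section \<open>The Galois action on a geometric fibre\<close>

text \<open>Isolates the cartesian square over the spectrum of the rationals on which the Galois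
  action is built.\<close>

locale geometric_fibre =
  fixes \<F> :: "'u geometric_fibre"
  assumes Spec_rat: "Spec_rat (SpecQ \<F>)"
    and structure_mor: "morphism (Fib \<F>) (SpecQ \<F>) (structure_map \<F>)"
    and spectrum: "spectrum_of Qbar (SpecQbar \<F>) (coord \<F>)"
    and base_mor: "morphism (SpecQbar \<F>) (SpecQ \<F>) (base_map \<F>)"
    and product: "fibre_product (Fib \<F>) (SpecQbar \<F>) (SpecQ \<F>) (structure_map \<F>) (base_map \<F>)
      (GFib \<F>) (to_Fib \<F>) (to_SpecQbar \<F>)"
begin

abbreviation "G \<equiv> GFib \<F>"
abbreviation "S \<equiv> SpecQbar \<F>"
abbreviation "spec_auto \<sigma> g \<equiv> spec_map S (coord \<F>) Qbar S (coord \<F>) (inv_into UNIV \<sigma>) g"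

lemma S_field: "field_spectrum S" and coord_iso: "coord \<F> \<in> ring_iso Qbar (global S)"
  using spectrum by (simp_all add: spectrum_of_def)

lemma S_sheaf: "sheaf_of_rings S"
  by (rule field_spectrumD(2)[OF S_field])

lemma coord_surj: "c \<in> carrier (global S) \<Longrightarrow> \<exists>a. c = coord \<F> a"
  using coord_iso by (auto simp: ring_iso_def bij_betw_def)

lemma coord_closed: "coord \<F> a \<in> carrier (global S)"
  using coord_iso by (auto simp: ring_iso_def ring_hom_def Qbar_simps)

lemma G_scheme: "scheme G" and to_Fib: "morphism G (Fib \<F>) (to_Fib \<F>)"
  and to_S: "morphism G S (to_SpecQbar \<F>)"
  and square: "eq_mor G (SpecQ \<F>) (comp_mor (Fib \<F>) (structure_map \<F>) (to_Fib \<F>))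
    (comp_mor S (base_map \<F>) (to_SpecQbar \<F>))"
  using product by (simp_all add: fibre_product_def)

section \<open>Automorphisms of the spectrum of \<open>Qbar\<close>\<close>

lemma spec_autoD:
  assumes "spec_auto \<sigma> g"
  shows "morphism S S g" "sh g (space S) (coord \<F> a) = coord \<F> (inv_into UNIV \<sigma> a)"
  using assms by (simp_all add: spec_map_def Qbar_simps)

lemma spec_auto_exists:
  assumes \<sigma>: "\<sigma> \<in> ring_iso Qbar Qbar"
  obtains g where "spec_auto \<sigma> g"
proof -
  let ?\<iota> = "coord \<F>"
  have "inv_into UNIV ?\<iota> \<in> ring_iso (global S) Qbar"
    using ring_iso_set_sym[OF ring_from_type_algebra coord_iso] by (simp add: Qbar_simps)
  then have "?\<iota> \<circ> (inv_into UNIV \<sigma> \<circ> inv_into UNIV ?\<iota>) \<in> ring_iso (global S) (global S)"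
    using coord_iso Qbar_auto_inv[OF \<sigma>] by (intro ring_iso_set_trans)
  then obtain g where g: "morphism S S g" "\<And>c. c \<in> carrier (global S) \<Longrightarrow>
      sh g (space S) c = (?\<iota> \<circ> (inv_into UNIV \<sigma> \<circ> inv_into UNIV ?\<iota>)) c"
    using field_spectrum_endomorphism[OF S_field] by blast
  have "inj ?\<iota>" using coord_iso by (simp add: ring_iso_def bij_betw_def Qbar_simps)
  with g have "spec_auto \<sigma> g" by (simp add: spec_map_def coord_closed)
  then show ?thesis by (rule that)
qed

lemma spec_auto_unique:
  assumes "spec_auto \<sigma> g" "spec_auto \<sigma> g'"
  shows "eq_mor S S g g'"
  using spec_autoD[OF assms(1)] spec_autoD[OF assms(2)] coord_surj
  by (intro eq_mor_field_spectrum[OF S_field S_sheaf]) force+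

lemma base_spec_auto:
  assumes "spec_auto \<sigma> g"
  shows "eq_mor S (SpecQ \<F>) (comp_mor S (base_map \<F>) g) (base_map \<F>)"
  by (intro eq_mor_Spec_rat Spec_rat S_sheaf base_mor morphism_comp[OF spec_autoD(1)[OF assms]])

lemma galois_morE:
  assumes "galois_mor \<F> \<sigma> h"
  obtains g where "morphism G G h" "eq_mor G (Fib \<F>) (comp_mor G (to_Fib \<F>) h) (to_Fib \<F>)"
    "spec_auto \<sigma> g" "eq_mor G S (comp_mor G (to_SpecQbar \<F>) h) (comp_mor S g (to_SpecQbar \<F>))"
  using assms by (auto simp: galois_mor_def)

text \<open>The universal property of \<open>GFib\<close> is applied to \<open>to_Fib\<close> and
  the twisted projection \<open>comp_mor S g (to_SpecQbar \<F>)\<close>. These agree over the base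
  because twisting by \<open>g\<close> does not change \<open>base_map \<F>\<close>.\<close>

lemma galois_mor_exists:
  assumes \<sigma>: "\<sigma> \<in> ring_iso Qbar Qbar"
  obtains h where "galois_mor \<F> \<sigma> h"
proof -
  obtain g where g: "spec_auto \<sigma> g" using spec_auto_exists[OF \<sigma>] by blast
  note gm = spec_autoD(1)[OF g]
  have "eq_mor G (SpecQ \<F>) (comp_mor S (base_map \<F>) (comp_mor S g (to_SpecQbar \<F>)))
      (comp_mor S (base_map \<F>) (to_SpecQbar \<F>))"
    using eq_mor_comp_right[OF to_S base_spec_auto[OF g]] by (simp add: comp_mor_assoc[OF gm])
  then have "eq_mor G (SpecQ \<F>) (comp_mor (Fib \<F>) (structure_map \<F>) (to_Fib \<F>))
      (comp_mor S (base_map \<F>) (comp_mor S g (to_SpecQbar \<F>)))"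
    using square eq_mor_sym eq_mor_trans by blast
  then obtain h where "morphism G G h" "eq_mor G (Fib \<F>) (comp_mor G (to_Fib \<F>) h) (to_Fib \<F>)"
    "eq_mor G S (comp_mor G (to_SpecQbar \<F>) h) (comp_mor S g (to_SpecQbar \<F>))"
    using product G_scheme to_Fib morphism_comp[OF to_S gm] unfolding fibre_product_def by metis
  with g have "galois_mor \<F> \<sigma> h" by (auto simp: galois_mor_def)
  then show ?thesis by (rule that)
qed

text \<open>Makes \<open>galois_act\<close> independent of the choice in its definition. The
  morphism \<open>g\<close> is itself only given by existence, so the two candidates for it are
  compared before the universal property is used.\<close>

lemma galois_mor_unique:
  assumes "galois_mor \<F> \<sigma> h" "galois_mor \<F> \<sigma> h'"
  shows "eq_mor G G h h'"
proof -
  obtain g where h: "morphism G G h" "eq_mor G (Fib \<F>) (comp_mor G (to_Fib \<F>) h) (to_Fib \<F>)"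
    "spec_auto \<sigma> g" "eq_mor G S (comp_mor G (to_SpecQbar \<F>) h) (comp_mor S g (to_SpecQbar \<F>))"
    using galois_morE[OF assms(1)] .
  obtain g' where h': "morphism G G h'" "eq_mor G (Fib \<F>) (comp_mor G (to_Fib \<F>) h') (to_Fib \<F>)"
    "spec_auto \<sigma> g'" "eq_mor G S (comp_mor G (to_SpecQbar \<F>) h') (comp_mor S g' (to_SpecQbar \<F>))"
    using galois_morE[OF assms(2)] .
  have "eq_mor G S (comp_mor S g (to_SpecQbar \<F>)) (comp_mor S g' (to_SpecQbar \<F>))"
    by (rule eq_mor_comp_right[OF to_S spec_auto_unique[OF h(3) h'(3)]])
  then have "eq_mor G S (comp_mor G (to_SpecQbar \<F>) h) (comp_mor G (to_SpecQbar \<F>) h')"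
    using h(4) h'(4) eq_mor_sym eq_mor_trans by metis
  moreover have "eq_mor G (Fib \<F>) (comp_mor G (to_Fib \<F>) h) (comp_mor G (to_Fib \<F>) h')"
    using h(2) h'(2) eq_mor_sym eq_mor_trans by metis
  ultimately show ?thesis
    by (intro fibre_product_unique[OF product structure_mor base_mor G_scheme h(1) h'(1)])
qed

lemma galois_mor_id: "galois_mor \<F> id id_mor"
proof -
  have "spec_auto id id_mor"
    unfolding spec_map_def by (simp add: morphism_id inv_id) (simp add: id_mor_def)
  moreover have "eq_mor G S (comp_mor G (to_SpecQbar \<F>) id_mor) (comp_mor S id_mor (to_SpecQbar \<F>))"
    using comp_mor_id[OF to_S] eq_mor_sym eq_mor_trans by metis
  ultimately show ?thesis
    unfolding galois_mor_def using morphism_id comp_mor_id(1)[OF to_Fib] by blast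
qed

text \<open>Passing to spectra reverses the order of composition and inversion reverses it again, so
  the morphisms compose in the same order as the automorphisms.\<close>

lemma galois_mor_comp:
  assumes \<sigma>: "\<sigma> \<in> ring_iso Qbar Qbar" and \<tau>: "\<tau> \<in> ring_iso Qbar Qbar"
    and "galois_mor \<F> \<sigma> h" "galois_mor \<F> \<tau> k"
  shows "galois_mor \<F> (\<sigma> \<circ> \<tau>) (comp_mor G h k)"
proof -
  obtain g where h: "morphism G G h" "eq_mor G (Fib \<F>) (comp_mor G (to_Fib \<F>) h) (to_Fib \<F>)"
    "spec_auto \<sigma> g" "eq_mor G S (comp_mor G (to_SpecQbar \<F>) h) (comp_mor S g (to_SpecQbar \<F>))"
    using galois_morE[OF assms(3)] .
  obtain l where k: "morphism G G k" "eq_mor G (Fib \<F>) (comp_mor G (to_Fib \<F>) k) (to_Fib \<F>)"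
    "spec_auto \<tau> l" "eq_mor G S (comp_mor G (to_SpecQbar \<F>) k) (comp_mor S l (to_SpecQbar \<F>))"
    using galois_morE[OF assms(4)] .
  note g = spec_autoD[OF h(3)] and l = spec_autoD[OF k(3)]
  have "eq_mor G (Fib \<F>) (comp_mor G (to_Fib \<F>) (comp_mor G h k)) (comp_mor G (to_Fib \<F>) k)"
    using eq_mor_comp_right[OF k(1) h(2)] by (simp add: comp_mor_assoc[OF h(1)])
  then have Fib: "eq_mor G (Fib \<F>) (comp_mor G (to_Fib \<F>) (comp_mor G h k)) (to_Fib \<F>)"
    using k(2) eq_mor_trans by blast
  have "eq_mor G S (comp_mor G (to_SpecQbar \<F>) (comp_mor G h k))
      (comp_mor S g (comp_mor G (to_SpecQbar \<F>) k))"
    using eq_mor_comp_right[OF k(1) h(4)] by (simp add: comp_mor_assoc[OF h(1)] comp_mor_assoc[OF to_S])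
  also have "eq_mor G S \<dots> (comp_mor S g (comp_mor S l (to_SpecQbar \<F>)))"
    by (rule eq_mor_comp_left[OF g(1) k(4)])
  finally have S: "eq_mor G S (comp_mor G (to_SpecQbar \<F>) (comp_mor G h k))
      (comp_mor S (comp_mor S g l) (to_SpecQbar \<F>))"
    by (simp add: comp_mor_assoc[OF l(1)])
  have "inv_into UNIV (\<sigma> \<circ> \<tau>) = inv_into UNIV \<tau> \<circ> inv_into UNIV \<sigma>"
    by (rule o_inv_distrib[OF Qbar_auto_hom(4)[OF \<sigma>] Qbar_auto_hom(4)[OF \<tau>]])
  then have "spec_auto (\<sigma> \<circ> \<tau>) (comp_mor S g l)"
    unfolding spec_map_def
    by (simp add: morphism_comp[OF l(1) g(1)]) (simp add: comp_mor_def preim_space[OF g(1)] g(2) l(2))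
  with Fib S show ?thesis
    unfolding galois_mor_def using morphism_comp[OF k(1) h(1)] by blast
qed

lemma galois_act_eq:
  assumes "galois_mor \<F> \<sigma> h" "Z \<subseteq> space G"
  shows "galois_act \<F> \<sigma> Z = pt h ` Z"
proof -
  have "galois_mor \<F> \<sigma> (SOME h. galois_mor \<F> \<sigma> h)"
    using assms(1) by (rule someI)
  from galois_mor_unique[OF this assms(1)] show ?thesis
    unfolding galois_act_def using assms(2) by (intro image_cong) (auto simp: eq_mor_def)
qed

lemma galois_act_comp:
  assumes \<sigma>: "\<sigma> \<in> ring_iso Qbar Qbar" and \<tau>: "\<tau> \<in> ring_iso Qbar Qbar" and Z: "Z \<subseteq> space G"
  shows "galois_act \<F> (\<sigma> \<circ> \<tau>) Z = galois_act \<F> \<sigma> (galois_act \<F> \<tau> Z)"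
proof -
  obtain h k where hk: "galois_mor \<F> \<sigma> h" "galois_mor \<F> \<tau> k"
    using galois_mor_exists \<sigma> \<tau> by meson
  then have "pt k ` Z \<subseteq> space G"
    using Z morphism_pt by (fastforce elim: galois_morE)
  then show ?thesis
    by (simp add: galois_act_eq[OF galois_mor_comp[OF \<sigma> \<tau> hk] Z] galois_act_eq[OF hk(2) Z]
        galois_act_eq[OF hk(1)] comp_mor_def image_comp)
qed

text \<open>The twist by \<rho> is invisible in the model \<open>F'\<close> over \<open>E\<close>:
  the maps \<open>r\<close> and \<open>comp_mor G r h\<close> have the same projections from
  \<open>F'\<close>, so they coincide, and \<open>Z\<close> is a preimage under
  \<open>r\<close>.\<close>

lemma galois_mor_preserves:
  assumes "defined_over \<F> E Z" "\<rho> \<in> Gal E" "galois_mor \<F> \<rho> h"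
  shows "pt h ` Z \<subseteq> Z"
proof -
  obtain S' \<iota> e b F' p q r Z0 where
    S': "spectrum_of (Qbar\<lparr>carrier := E\<rparr>) S' \<iota>" and
    e: "spec_map S (coord \<F>) (Qbar\<lparr>carrier := E\<rparr>) S' \<iota> id e" and
    b: "morphism S' (SpecQ \<F>) b" and
    fp: "fibre_product (Fib \<F>) S' (SpecQ \<F>) (structure_map \<F>) b F' p q" and
    r: "morphism G F' r" "eq_mor G (Fib \<F>) (comp_mor F' p r) (to_Fib \<F>)"
      "eq_mor G S' (comp_mor F' q r) (comp_mor S e (to_SpecQbar \<F>))" and
    Z: "Z = preim G r Z0"
    using assms(1) unfolding defined_over_def by blast
  obtain g where h: "morphism G G h" "eq_mor G (Fib \<F>) (comp_mor G (to_Fib \<F>) h) (to_Fib \<F>)"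
    "spec_auto \<rho> g" "eq_mor G S (comp_mor G (to_SpecQbar \<F>) h) (comp_mor S g (to_SpecQbar \<F>))"
    using galois_morE[OF assms(3)] .
  note g = spec_autoD[OF h(3)]
  have em: "morphism S S' e" and e_sh: "\<And>c. c \<in> E \<Longrightarrow> sh e (space S') (\<iota> c) = coord \<F> c"
    using e by (simp_all add: spec_map_def)
  have pq: "morphism F' (Fib \<F>) p" "morphism F' S' q"
    using fp by (simp_all add: fibre_product_def)
  have "bij \<rho>" and \<rho>: "\<And>c. c \<in> E \<Longrightarrow> \<rho> c = c"
    using assms(2) Qbar_auto_hom(4) by (auto simp: Gal_def)
  have "inv_into UNIV \<rho> c = c" if "c \<in> E" for c
    using inv_f_f[OF bij_is_inj[OF \<open>bij \<rho>\<close>], of c] \<rho>[OF that] by simp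
  moreover have "\<exists>c\<in>E. c' = \<iota> c" if "c' \<in> carrier (global S')" for c'
    using S' that by (auto simp: spectrum_of_def ring_iso_def bij_betw_def)
  moreover have "field_spectrum S'" using S' by (simp add: spectrum_of_def)
  \<comment> \<open>The inverse of \<rho> fixes \<open>E\<close> pointwise, and a morphism to the
    spectrum of \<open>E\<close> is determined by its effect on \<open>E\<close>.\<close>
  ultimately have eg: "eq_mor S S' (comp_mor S e g) e"
    by (intro eq_mor_field_spectrum S_sheaf morphism_comp[OF g(1) em] em)
      (fastforce simp: comp_mor_def preim_space[OF em] e_sh g(2))+
  have "eq_mor G S' (comp_mor F' q (comp_mor G r h)) (comp_mor S e (comp_mor G (to_SpecQbar \<F>) h))"
    using eq_mor_comp_right[OF h(1) r(3)] by (simp add: comp_mor_assoc[OF r(1)] comp_mor_assoc[OF to_S])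
  also have "eq_mor G S' \<dots> (comp_mor S (comp_mor S e g) (to_SpecQbar \<F>))"
    using eq_mor_comp_left[OF em h(4)] by (simp add: comp_mor_assoc[OF g(1)])
  also have "eq_mor G S' \<dots> (comp_mor S e (to_SpecQbar \<F>))"
    by (rule eq_mor_comp_right[OF to_S eg])
  also have "eq_mor G S' \<dots> (comp_mor F' q r)"
    by (rule eq_mor_sym[OF r(3)])
  finally have q: "eq_mor G S' (comp_mor F' q (comp_mor G r h)) (comp_mor F' q r)" .
  have "eq_mor G (Fib \<F>) (comp_mor F' p (comp_mor G r h)) (comp_mor G (to_Fib \<F>) h)"
    using eq_mor_comp_right[OF h(1) r(2)] by (simp add: comp_mor_assoc[OF r(1)])
  also note h(2)
  also note eq_mor_sym[OF r(2)]
  finally have "eq_mor G F' (comp_mor G r h) r"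
    by (intro fibre_product_unique[OF fp structure_mor b G_scheme morphism_comp[OF h(1) r(1)] r(1) _ q])
  then show ?thesis
    using morphism_pt[OF h(1)] by (auto simp: Z preim_def eq_mor_def comp_mor_def)
qed

text \<open>The inclusion already proved is applied to \<rho> and to its inverse, which also fixes
  \<open>E\<close>: each point of \<open>Z\<close> is the image under \<open>h\<close> of a point of
  \<open>Z\<close>.\<close>

lemma galois_act_trivial:
  assumes "defined_over \<F> E Z" "\<rho> \<in> Gal E"
  shows "galois_act \<F> \<rho> Z = Z"
proof -
  have Z: "Z \<subseteq> space G" using assms(1) by (auto simp: defined_over_def preim_def)
  have \<rho>: "\<rho> \<in> ring_iso Qbar Qbar" using assms(2) by (simp add: Gal_def)
  let ?\<rho>' = "inv_into UNIV \<rho>"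
  note \<rho>' = Qbar_auto_inv[OF \<rho>] and bij = Qbar_auto_hom(4)[OF \<rho>]
  have "?\<rho>' c = c" if "\<rho> c = c" for c
    using inv_f_f[OF bij_is_inj[OF bij], of c] that by simp
  then have Gal': "?\<rho>' \<in> Gal E" using assms(2) \<rho>' by (simp add: Gal_def)
  obtain h h' where h: "galois_mor \<F> \<rho> h" and h': "galois_mor \<F> ?\<rho>' h'"
    using galois_mor_exists \<rho> \<rho>' by meson
  have "\<rho> \<circ> ?\<rho>' = id" using bij_is_surj[OF bij] by (simp only: surj_iff)
  then have "eq_mor G G (comp_mor G h h') id_mor"
    using galois_mor_unique[OF _ galois_mor_id] galois_mor_comp[OF \<rho> \<rho>' h h'] by simp
  then have "pt h (pt h' x) = x" if "x \<in> Z" for x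
    using Z that by (auto simp: eq_mor_def comp_mor_def id_mor_def)
  then have "Z \<subseteq> pt h ` Z"
    using galois_mor_preserves[OF assms(1) Gal' h'] by force
  with galois_mor_preserves[OF assms h] show ?thesis
    by (simp add: galois_act_eq[OF h Z])
qed

end

theorem theorem1p4:
  fixes B \<XX> P :: "'u ringed_space" and s \<pi> :: "'u morph" and D :: 'u
    and \<F> :: "'u geometric_fibre"
    and E N :: "rat alg_closure set"
  assumes "standard_fibration B \<XX> s P \<pi>"
    and "closed_point P D"
    and "geometric_fibre_at B \<XX> s P \<pi> D \<F>"
    and "field_of_definition_of_comps \<F> E"
    and "number_field N"
  shows "delta \<F> N = delta \<F> (N \<inter> normal_closure E)"
proof -
  let ?M = "normal_closure E"
  interpret geometric_fibre \<F>
    using assms(1,3) by unfold_locales (auto simp: standard_fibration_def geometric_fibre_at_def)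
  have N: "subfield N Qbar" using assms(5) by (simp add: number_field_def)
  have space: "Z \<subseteq> space (GFib \<F>)" if "Z \<in> S_comps \<F>" for Z
    using that by (auto simp: S_comps_def irreducible_components_def irreducible_in_def)
  have trivial: "galois_act \<F> \<rho> Z = Z" if \<rho>: "\<rho> \<in> Gal ?M" and Z: "Z \<in> S_comps \<F>" for \<rho> Z
  proof -
    \<comment> \<open>In the reading by single elements, \<open>Z\<close> is defined over a
      conjugate of \<open>E\<close> that may vary with \<open>Z\<close>. Every such conjugate lies
      in \<open>?M\<close>, which is stable under automorphisms.\<close>
    have "\<exists>K \<subseteq> ?M. defined_over \<F> K Z"
      using assms(4) unfolding field_of_definition_of_comps_def
    proof (elim conjE disjE)
      assume "\<forall>Z \<in> S_comps \<F>. \<exists>\<sigma> \<in> Gal (range to_ac). field_of_definition \<F> {Z} (\<sigma> ` E)"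
      with Z obtain \<sigma> where "\<sigma> \<in> ring_iso Qbar Qbar" "field_of_definition \<F> {Z} (\<sigma> ` E)"
        by (auto simp: Gal_def)
      then show ?thesis
        using normal_closure_auto subset_normal_closure[of E]
        by (intro exI[of _ "\<sigma> ` E"]) (auto simp: field_of_definition_def)
    next
      assume "field_of_definition \<F> (S_comps \<F>) E"
      then show ?thesis
        using Z subset_normal_closure[of E] by (auto simp: field_of_definition_def)
    qed
    then obtain K where "K \<subseteq> ?M" "defined_over \<F> K Z" by blast
    with \<rho> show ?thesis by (intro galois_act_trivial) (auto simp: Gal_def)
  qed
  \<comment> \<open>\<open>delta\<close> depends on the field only through this image, so numerator
    and denominator agree at once, without counting.\<close>
  have "galois_image \<F> (N \<inter> ?M) = galois_image \<F> N"
  proof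
    show "galois_image \<F> N \<subseteq> galois_image \<F> (N \<inter> ?M)"
      unfolding galois_image_def by (intro image_mono) (auto simp: Gal_def)
    show "galois_image \<F> (N \<inter> ?M) \<subseteq> galois_image \<F> N"
      unfolding galois_image_def
    proof (rule image_subsetI)
      fix \<sigma> assume "\<sigma> \<in> Gal (N \<inter> ?M)"
      then obtain \<tau> \<rho> where \<tau>: "\<tau> \<in> Gal N" and \<rho>: "\<rho> \<in> Gal ?M" and \<sigma>: "\<sigma> = \<tau> \<circ> \<rho>"
        using Gal_inter_normal_closure[OF N] by blast
      then have "galois_act \<F> \<sigma> Z = galois_act \<F> \<tau> Z" if "Z \<in> S_comps \<F>" for Z
        using galois_act_comp[OF _ _ space[OF that], of \<tau> \<rho>] trivial[OF \<rho> that]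
        by (simp add: Gal_def)
      then have "restrict (galois_act \<F> \<sigma>) (S_comps \<F>) = restrict (galois_act \<F> \<tau>) (S_comps \<F>)"
        by (rule restrict_ext)
      with \<tau> show "restrict (galois_act \<F> \<sigma>) (S_comps \<F>) \<in>
          (\<lambda>\<sigma>. restrict (galois_act \<F> \<sigma>) (S_comps \<F>)) ` Gal N"
        by (intro image_eqI[where x = \<tau>])
    qed
  qed
  then show ?thesis by (simp add: delta_def)
qed


end
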